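(* Let $Q(V_0)=R_1(V_1)\wedge\cdots\wedge R_m(V_m)$ be a conjunctive query with set of variables $\mathbf V=V_1\cup\cdots\cup V_m$ and $V_0\subseteq\mathbf V$, and let $\Sigma$ be a finite set of simple statistics $\sigma=(j_\sigma,U_\sigma,V_\sigma,p_\sigma,b_\sigma)$ for $Q$. Assume that the linear program $\mathrm{LP}_{\mathrm{base}}(Q,\Sigma)$ has a finite optimum. Let $h^*$ be an optimal solution, let $(w^*_\sigma)_{\sigma\in\Sigma}$, $(s^*_\tau)_\tau$ be an optimal solution of the dual linear program, where $w^*_\sigma\ge 0$ is the weight of the statistics constraint of $\sigma$ and $s^*_\tau\ge 0$ is the weight of the basic Shannon inequality $\tau$ (monotonicity or submodularity), and set $B=2^{h^*(V_0)}$. Then: 1. $B$ is a tight upper bound on $|Q|$: for every database $D$ that satisfies $\Sigma$ we have $|Q(D)|\le B$; and there is a constant $c_Q>0$, depending only on the query $Q$, such that some database $D$ satisfying $\Sigma$ has $|Q(D)|\ge c_Q\cdot B$. 2. The inequality $$|Q(D)|\le \prod_{\sigma\in\Sigma}\left(\|\deg_{R_{j_\sigma}}(V_\sigma\mid U_\sigma)\|_{p_\sigma}\right)^{w^*_\sigma}$$ holds for every database $D$ (whether or not $D$ satisfies $\Sigma$), and for the given values of the statistics $\prod_{\sigma\in\Sigma} b_\sigma^{w^*_\sigma}\le B$, so that the inequality implies $|Q(D)|\le B$ for every $D$ satisfying $\Sigma$. 3. The basic Shannon inequalities multiplied by the weights $s^*_\tau$ prove the information inequality underlying item 2. That is, writing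 each basic Shannon inequality $\tau$ as $L_\tau(h)\ge 0$ with $L_\tau$ a linear form, for every function $h:2^{\mathbf V}\to[0,\infty)$ with $h(\emptyset)=0$, $$\sum_{\sigma\in\Sigma} w^*_\sigma\left(\tfrac1{p_\sigma}h(U_\sigma)+h(V_\sigma\mid U_\sigma)\right)-h(V_0)\ \ge\ \sum_\tau s^*_\tau L_\tau(h);$$ consequently $h(V_0)\le\sum_{\sigma} w^*_\sigma\left(\tfrac1{p_\sigma}h(U_\sigma)+h(V_\sigma\mid U_\sigma)\right)$ for every $h$ satisfying all basic Shannon inequalities.
   Context: **Queries.** In a conjunctive query $Q(V_0)=R_1(V_1)\wedge\cdots\wedge R_m(V_m)$ (without selection predicates), each $R_j$ is a relation name whose set of attributes is the finite set of variables $V_j$. A database $D$ assigns to each $R_j$ a finite relation (set of tuples) over attributes $V_j$. $Q(D)$ is the set of tuples over $V_0$ (the group-by variables) obtained by projecting the natural join of $R_1,\dots,R_m$ onto $V_0$; $|Q(D)|$ is its cardinality. **Degree sequences.** For a relation $R$ and sets of attributes $U,V$ of $R$, let $u_1,\dots,u_N$ be the distinct values of $\Pi_U(R)$ and let $d_i=|\sigma_{U=u_i}(\Pi_{U\cup V}(R))|$. The degree sequence $\deg_R(V|U)$ is $(d_1,\dots,d_N)$ sorted in decreasing order. It is simple if $|U|\le 1$. For $p\in(0,\infty)$, $\|d\|_p=(\sum_i d_i^p)^{1/p}$, and $\|d\|_\infty=\max_i d_i$. **Statistics.** A simple statistic is a tuple $\sigma=(j,U,V,p,b)$ with $1\le j\le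 m$, $U,V\subseteq V_j$, $|U|\le 1$, $p\in(0,\infty]$ and a real $b\ge 1$. A database satisfies it if $\|\deg_{R_j}(V|U)\|_p\le b$, and satisfies $\Sigma$ if it satisfies all $\sigma\in\Sigma$. **$\mathrm{LP}_{\mathrm{base}}(Q,\Sigma)$.** Notation: $h(V|U)=h(U\cup V)-h(U)$; $\log$ is base 2; $1/\infty=0$. The variables are $h(U)\ge 0$ for all $U\subseteq\mathbf V$. Maximize $h(V_0)$ subject to: - statistics constraints: $\frac1p h(U)+h(V|U)\le\log b$ for each $(j,U,V,p,b)\in\Sigma$; - basic Shannon inequalities: $h(\emptyset)=0$; monotonicity $h(U\cup V)-h(U)\ge 0$; submodularity $h(U)+h(V)-h(U\cup V)-h(U\cap V)\ge 0$, for all $U,V\subseteq\mathbf V$. In the claim, $\tau$ ranges over the monotonicity and submodularity inequalities. *)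

theory Defs
  imports "HOL-Analysis.Analysis" "HOL-Library.Multiset"
begin

text \<open>
  The query \<open>Q(V\<^sub>0) = R\<^sub>1(V\<^sub>1) \<and> \<dots> \<and> R\<^sub>m(V\<^sub>m)\<close>: the relation names are the indices
  \<open>1, \<dots>, m\<close>, and only the values of \<open>attrs\<close> at these indices matter.
\<close>

record 'v cquery =
  natoms :: nat
  attrs :: "nat \<Rightarrow> 'v set"
  head :: "'v set"

definition query_vars :: "'v cquery \<Rightarrow> 'v set" where
  "query_vars Q = (\<Union>j\<in>{1..natoms Q}. attrs Q j)"

definition wf_query :: "'v cquery \<Rightarrow> bool" where
  "wf_query Q \<longleftrightarrow> (\<forall>j\<in>{1..natoms Q}. finite (attrs Q j)) \<and> head Q \<subseteq> query_vars Q"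

text \<open>A tuple over the attributes \<open>U\<close> is a partial map with domain exactly \<open>U\<close>.\<close>

type_synonym ('v, 'd) relation = "('v \<rightharpoonup> 'd) set"

definition database :: "'v cquery \<Rightarrow> (nat \<Rightarrow> ('v, 'd) relation) \<Rightarrow> bool" where
  "database Q D \<longleftrightarrow> (\<forall>j\<in>{1..natoms Q}. finite (D j) \<and> (\<forall>t\<in>D j. dom t = attrs Q j))"

definition project :: "'v set \<Rightarrow> ('v, 'd) relation \<Rightarrow> ('v, 'd) relation" where
  "project U R = (\<lambda>t. t |` U) ` R"

definition natural_join :: "'v cquery \<Rightarrow> (nat \<Rightarrow> ('v, 'd) relation) \<Rightarrow> ('v, 'd) relation" where
  "natural_join Q D = {t. dom t = query_vars Q \<and> (\<forall>j\<in>{1..natoms Q}. t |` attrs Q j \<in> D j)}"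

definition query_result :: "'v cquery \<Rightarrow> (nat \<Rightarrow> ('v, 'd) relation) \<Rightarrow> ('v, 'd) relation" where
  "query_result Q D = project (head Q) (natural_join Q D)"

text \<open>\<open>deg_seq R V U\<close> is the degree sequence \<open>deg\<^sub>R(V|U)\<close>, in decreasing order.\<close>

definition deg_seq :: "('v, 'd) relation \<Rightarrow> 'v set \<Rightarrow> 'v set \<Rightarrow> nat list" where
  "deg_seq R V U =
     rev (sorted_list_of_multiset
       (image_mset (\<lambda>u. card {t \<in> project (U \<union> V) R. t |` U = u}) (mset_set (project U R))))"

text \<open>The \<open>\<ell>\<^sub>p\<close>-norm for \<open>0 < p \<le> \<infinity>\<close>; the empty sequence has norm 0.\<close>

definition lp_norm :: "ereal \<Rightarrow> nat list \<Rightarrow> real" where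
  "lp_norm p d =
     (if p = \<infinity> then real (Max (insert 0 (set d)))
      else (\<Sum>x\<leftarrow>d. real x powr real_of_ereal p) powr (1 / real_of_ereal p))"

record 'v statistic =
  stat_rel :: nat
  stat_U :: "'v set"
  stat_V :: "'v set"
  stat_p :: ereal
  stat_b :: real

definition simple_statistic :: "'v cquery \<Rightarrow> 'v statistic \<Rightarrow> bool" where
  "simple_statistic Q \<sigma> \<longleftrightarrow>
     stat_rel \<sigma> \<in> {1..natoms Q} \<and>
     stat_U \<sigma> \<subseteq> attrs Q (stat_rel \<sigma>) \<and> stat_V \<sigma> \<subseteq> attrs Q (stat_rel \<sigma>) \<and>
     card (stat_U \<sigma>) \<le> 1 \<and> 0 < stat_p \<sigma> \<and> 1 \<le> stat_b \<sigma>"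

definition stat_norm :: "(nat \<Rightarrow> ('v, 'd) relation) \<Rightarrow> 'v statistic \<Rightarrow> real" where
  "stat_norm D \<sigma> = lp_norm (stat_p \<sigma>) (deg_seq (D (stat_rel \<sigma>)) (stat_V \<sigma>) (stat_U \<sigma>))"

definition satisfies :: "(nat \<Rightarrow> ('v, 'd) relation) \<Rightarrow> 'v statistic set \<Rightarrow> bool" where
  "satisfies D \<Sigma> \<longleftrightarrow> (\<forall>\<sigma>\<in>\<Sigma>. stat_norm D \<sigma> \<le> stat_b \<sigma>)"

definition cond :: "('v set \<Rightarrow> real) \<Rightarrow> 'v set \<Rightarrow> 'v set \<Rightarrow> real" where
  "cond h V U = h (U \<union> V) - h U"

text \<open>In \<^typ>\<open>ereal\<close>, \<open>1 / \<infinity> = 0\<close>.\<close>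

definition stat_form :: "'v statistic \<Rightarrow> ('v set \<Rightarrow> real) \<Rightarrow> real" where
  "stat_form \<sigma> h =
     real_of_ereal (1 / stat_p \<sigma>) * h (stat_U \<sigma>) + cond h (stat_V \<sigma>) (stat_U \<sigma>)"

datatype 'v shannon = Mono "'v set" "'v set" | Submod "'v set" "'v set"

definition shannon_ineqs :: "'v set \<Rightarrow> 'v shannon set" where
  "shannon_ineqs X =
     {Mono U V | U V. U \<subseteq> X \<and> V \<subseteq> X} \<union> {Submod U V | U V. U \<subseteq> X \<and> V \<subseteq> X}"

fun shannon_form :: "'v shannon \<Rightarrow> ('v set \<Rightarrow> real) \<Rightarrow> real" where
  "shannon_form (Mono U V) h = h (U \<union> V) - h U"
| "shannon_form (Submod U V) h = h U + h V - h (U \<union> V) - h (U \<inter> V)"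

definition basic_shannon :: "'v set \<Rightarrow> ('v set \<Rightarrow> real) \<Rightarrow> bool" where
  "basic_shannon X h \<longleftrightarrow> h {} = 0 \<and> (\<forall>\<tau>\<in>shannon_ineqs X. shannon_form \<tau> h \<ge> 0)"

definition primal_feasible ::
    "'v cquery \<Rightarrow> 'v statistic set \<Rightarrow> ('v set \<Rightarrow> real) \<Rightarrow> bool" where
  "primal_feasible Q \<Sigma> h \<longleftrightarrow>
     (\<forall>U\<subseteq>query_vars Q. 0 \<le> h U) \<and>
     (\<forall>\<sigma>\<in>\<Sigma>. stat_form \<sigma> h \<le> log 2 (stat_b \<sigma>)) \<and>
     basic_shannon (query_vars Q) h"

definition primal_optimal ::
    "'v cquery \<Rightarrow> 'v statistic set \<Rightarrow> ('v set \<Rightarrow> real) \<Rightarrow> bool" where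
  "primal_optimal Q \<Sigma> h \<longleftrightarrow>
     primal_feasible Q \<Sigma> h \<and> (\<forall>g. primal_feasible Q \<Sigma> g \<longrightarrow> g (head Q) \<le> h (head Q))"

text \<open>The coefficient of the variable \<open>h(W)\<close> in a linear form is its value at the unit vector of \<open>W\<close>.\<close>

definition coeff_at :: "(('v set \<Rightarrow> real) \<Rightarrow> real) \<Rightarrow> 'v set \<Rightarrow> real" where
  "coeff_at L W = L (\<lambda>U. of_bool (U = W))"

text \<open>
  The dual program has a variable \<open>w \<sigma> \<ge> 0\<close> for each statistics constraint, \<open>s \<tau> \<ge> 0\<close> for each
  Shannon inequality (read as \<open>- L\<^sub>\<tau>(h) \<le> 0\<close>) and an unrestricted \<open>y\<close> for the equation
  \<open>h(\<emptyset>) = 0\<close>.  It has one constraint per primal variable \<open>h(W) \<ge> 0\<close>.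
\<close>

definition dual_feasible ::
    "'v cquery \<Rightarrow> 'v statistic set \<Rightarrow> ('v statistic \<Rightarrow> real) \<Rightarrow> ('v shannon \<Rightarrow> real) \<Rightarrow> real \<Rightarrow> bool"
  where
  "dual_feasible Q \<Sigma> w s y \<longleftrightarrow>
     (\<forall>\<sigma>\<in>\<Sigma>. 0 \<le> w \<sigma>) \<and> (\<forall>\<tau>\<in>shannon_ineqs (query_vars Q). 0 \<le> s \<tau>) \<and>
     (\<forall>W\<subseteq>query_vars Q.
        (\<Sum>\<sigma>\<in>\<Sigma>. w \<sigma> * coeff_at (stat_form \<sigma>) W)
        - (\<Sum>\<tau>\<in>shannon_ineqs (query_vars Q). s \<tau> * coeff_at (shannon_form \<tau>) W)
        + y * coeff_at (\<lambda>h. h {}) W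
        \<ge> coeff_at (\<lambda>h. h (head Q)) W)"

definition dual_value :: "'v statistic set \<Rightarrow> ('v statistic \<Rightarrow> real) \<Rightarrow> real" where
  "dual_value \<Sigma> w = (\<Sum>\<sigma>\<in>\<Sigma>. w \<sigma> * log 2 (stat_b \<sigma>))"

definition dual_optimal ::
    "'v cquery \<Rightarrow> 'v statistic set \<Rightarrow> ('v statistic \<Rightarrow> real) \<Rightarrow> ('v shannon \<Rightarrow> real) \<Rightarrow> real \<Rightarrow> bool"
  where
  "dual_optimal Q \<Sigma> w s y \<longleftrightarrow>
     dual_feasible Q \<Sigma> w s y \<and>
     (\<forall>w' s' y'. dual_feasible Q \<Sigma> w' s' y' \<longrightarrow> dual_value \<Sigma> w \<le> dual_value \<Sigma> w')"

text \<open>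
  The product of the norms \<open>stat_norm D \<sigma>\<close> raised to the weights.  The library's \<open>0 powr 0 = 0\<close>
  is relevant only if some relation of \<open>D\<close> is empty, and then the query result is empty, too.
\<close>

definition norm_product ::
    "'v statistic set \<Rightarrow> ('v statistic \<Rightarrow> real) \<Rightarrow> (nat \<Rightarrow> ('v, 'd) relation) \<Rightarrow> real" where
  "norm_product \<Sigma> w D = (\<Prod>\<sigma>\<in>\<Sigma>. stat_norm D \<sigma> powr w \<sigma>)"

end

theory Submission
  imports Defs
begin

text \<open>
  Upper bound: for the uniform distribution on a set of join tuples representing the output, the
  marginal entropies form a basic Shannon function whose value at the head is \<open>log |Q(D)|\<close>, and
  every statistics form is at most the logarithm of the corresponding norm; combine this with the
  dual solution.

  Tightness: as \<open>|U| \<le> 1\<close> in every statistic, only \<open>h(\<emptyset>)\<close> and the values of \<open>h\<close> on singletons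
  can occur negatively in a constraint.  Hence \<open>h\<close> may be replaced by a function \<open>g \<le> h\<close> that agrees
  with \<open>h\<close> there and at the head and is a nonnegative combination of step functions
  \<open>S \<mapsto> [W \<inter> S \<noteq> \<emptyset>]\<close>.  Such a \<open>g\<close> is realised by a product database with one independent
  coordinate for each \<open>W\<close>, of size \<open>2\<close> to the coefficient of \<open>W\<close>; rounding the sizes down loses a
  factor of at most \<open>2\<close> per coordinate.
\<close>

section \<open>Farkas' lemma and strong duality\<close>

text \<open>A function satisfying the basic Shannon inequalities need not be the entropy of any
  distribution, so an optimal \<open>h\<close> cannot in general be turned into a database directly;
  this is why the lower bound passes to another function first. Strong duality is needed because
  \<open>w\<close> is known only to be dual optimal: its dual value has to be compared with
  \<open>h (head Q)\<close> before the product of the \<open>stat_b \<sigma>\<close> can be bounded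
  by \<open>B\<close>. Farkas' lemma is stated for finitely many linear forms on a space of
  functions of any dimension, which fits functions on all sets over a possibly infinite type of
  variables. The entropy inequalities share one argument: the mean over the tuples of a suitable
  ratio built from fibre sizes is at most 1, and log x \<le> (x - 1) / ln 2 then makes the mean of
  its logarithm at most 0. No convexity theory is involved.\<close>

definition linear_form :: "(('a \<Rightarrow> real) \<Rightarrow> real) \<Rightarrow> bool" where
  "linear_form L \<longleftrightarrow> (\<forall>x y r. L (\<lambda>k. x k + r * y k) = L x + r * L y)"

lemma linear_formD: "linear_form L \<Longrightarrow> L (\<lambda>k. x k + r * y k) = L x + r * L y"
  by (simp add: linear_form_def)

lemma linear_form_zero:
  assumes "linear_form L"
  shows "L (\<lambda>_. 0) = 0"
  using linear_formD[OF assms, of "\<lambda>_. 0" 1 "\<lambda>_. 0"] by simp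

lemma linear_form_scale:
  assumes "linear_form L"
  shows "L (\<lambda>k. r * x k) = r * L x"
  using linear_formD[OF assms, of "\<lambda>_. 0" r x] linear_form_zero[OF assms] by simp

text \<open>Bartl's induction on the number of forms: a point \<open>x\<^sub>0\<close> violating the implication without the
  form \<open>a j\<close> has \<open>a j x\<^sub>0 > 0\<close>, and projecting along \<open>x\<^sub>0\<close> onto the kernel of \<open>a j\<close> eliminates \<open>a j\<close>.\<close>

lemma farkas:
  fixes c :: "('a \<Rightarrow> real) \<Rightarrow> real"
  assumes "finite I" "linear_form c" "\<And>i. i \<in> I \<Longrightarrow> linear_form (a i)"
    and "\<And>x. (\<And>i. i \<in> I \<Longrightarrow> a i x \<le> 0) \<Longrightarrow> c x \<le> 0"
  shows "\<exists>l. (\<forall>i\<in>I. 0 \<le> l i) \<and> (\<forall>x. c x = (\<Sum>i\<in>I. l i * a i x))"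
  using assms
proof (induction I arbitrary: a c rule: finite_induct)
  case empty
  have "c x = 0" for x
    using empty.prems(3)[of x] empty.prems(3)[of "\<lambda>k. (-1) * x k"]
      linear_form_scale[OF empty.prems(1), of "-1" x] by simp
  then show ?case by simp
next
  case (insert j I)
  show ?case
  proof (cases "\<forall>x. (\<forall>i\<in>I. a i x \<le> 0) \<longrightarrow> c x \<le> 0")
    case True
    obtain l where l: "\<forall>i\<in>I. 0 \<le> l i" "\<And>x. c x = (\<Sum>i\<in>I. l i * a i x)"
      using insert.IH[of c a] insert.prems(1,2) True by blast
    have "c x = (\<Sum>i\<in>insert j I. (l(j := 0)) i * a i x)" for x
      using insert.hyps l(2)[of x] by (auto intro!: sum.cong)
    then show ?thesis using l(1) by (intro exI[of _ "l(j := 0)"]) auto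
  next
    case False
    then obtain x0 where x0: "\<And>i. i \<in> I \<Longrightarrow> a i x0 \<le> 0" "c x0 > 0"
      by (auto simp: not_le)
    have pos: "a j x0 > 0"
      using insert.prems(3)[of x0] x0 by (cases "a j x0 \<le> 0") auto
    \<comment> \<open>\<open>a' i x\<close> and \<open>c' x\<close> are the values of
      \<open>a i\<close> and \<open>c\<close> at the projection \<open>z\<close> of \<open>x\<close>
      defined below.\<close>
    define a' where "a' = (\<lambda>i x. a i x - a i x0 / a j x0 * a j x)"
    define c' where "c' = (\<lambda>x. c x - c x0 / a j x0 * a j x)"
    have lin: "linear_form (a i)" if "i \<in> insert j I" for i using insert.prems(2) that by blast
    have lin': "linear_form (a' i)" if "i \<in> I" for i
      using linear_formD[OF lin[of i]] linear_formD[OF lin[of j]] that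
      by (simp add: a'_def linear_form_def algebra_simps add_divide_distrib)
    have linc': "linear_form c'"
      using linear_formD[OF insert.prems(1)] linear_formD[OF lin[of j]]
      by (simp add: c'_def linear_form_def algebra_simps add_divide_distrib)
    have "c' x \<le> 0" if "\<And>i. i \<in> I \<Longrightarrow> a' i x \<le> 0" for x
    proof -
      define z where "z = (\<lambda>k. x k + (- (a j x / a j x0)) * x0 k)"
      have z: "L z = L x - L x0 / a j x0 * a j x" if "linear_form L" for L
        using linear_formD[OF that, of x "- (a j x / a j x0)" x0] by (simp add: z_def)
      have "a i z \<le> 0" if "i \<in> insert j I" for i
      proof (cases "i = j")
        case True
        then show ?thesis using z[OF lin[of j]] pos by simp
      next
        case False
        then show ?thesis using z[OF lin[of i]] that \<open>\<And>i. i \<in> I \<Longrightarrow> a' i x \<le> 0\<close>[of i]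
          by (simp add: a'_def)
      qed
      then have "c z \<le> 0" by (rule insert.prems(3))
      then show ?thesis using z[OF insert.prems(1)] by (simp add: c'_def)
    qed
    then obtain l where l: "\<forall>i\<in>I. 0 \<le> l i" "\<And>x. c' x = (\<Sum>i\<in>I. l i * a' i x)"
      using insert.IH[of c' a'] linc' lin' by blast
    \<comment> \<open>Rewriting the representation of \<open>c'\<close> in terms of \<open>c\<close>
      and the \<open>a i\<close> leaves this coefficient for \<open>a j x\<close>. It is nonnegative
      because \<open>c x0 > 0\<close> while \<open>a i x0 \<le> 0\<close> for all
      \<open>i \<in> I\<close>.\<close>
    define m where "m = (c x0 - (\<Sum>i\<in>I. l i * a i x0)) / a j x0"
    have "(\<Sum>i\<in>I. l i * a i x0) \<le> 0"
      using l(1) x0(1) by (intro sum_nonpos) (simp add: mult_nonneg_nonpos)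
    then have "0 \<le> m" using x0(2) pos by (simp add: m_def)
    have "c x = (\<Sum>i\<in>I. l i * a i x) + m * a j x" for x
    proof -
      have "(\<Sum>i\<in>I. l i * a' i x)
          = (\<Sum>i\<in>I. l i * a i x) - (\<Sum>i\<in>I. l i * a i x0) / a j x0 * a j x"
        by (simp add: a'_def algebra_simps sum_subtractf sum_distrib_left sum_divide_distrib)
      then show ?thesis using l(2)[of x]
        by (simp add: c'_def m_def diff_divide_distrib algebra_simps)
    qed
    moreover have "(\<Sum>i\<in>I. (l(j := m)) i * a i x) = (\<Sum>i\<in>I. l i * a i x)" for x
      using insert.hyps by (intro sum.cong) auto
    ultimately have "c x = (\<Sum>i\<in>insert j I. (l(j := m)) i * a i x)" for x
      using insert.hyps by simp
    then show ?thesis using l(1) \<open>0 \<le> m\<close> by (intro exI[of _ "l(j := m)"]) auto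
  qed
qed

section \<open>The homogenised linear program and its dual\<close>

lemma linear_form_stat_form: "linear_form (stat_form \<sigma>)"
  by (simp add: linear_form_def stat_form_def cond_def algebra_simps)

lemma linear_form_shannon_form: "linear_form (shannon_form \<tau>)"
  by (cases \<tau>) (simp_all add: linear_form_def algebra_simps)

lemma finite_shannon_ineqs:
  assumes "finite X"
  shows "finite (shannon_ineqs X)"
proof -
  have "shannon_ineqs X = case_prod Mono ` (Pow X \<times> Pow X) \<union> case_prod Submod ` (Pow X \<times> Pow X)"
    by (auto simp: shannon_ineqs_def)
  then show ?thesis using assms by simp
qed

text \<open>This serves the points of the homogenised program whose homogenising coordinate is 0.
  They cannot be rescaled to feasible functions, but adding one to an optimal function shows that it
  cannot increase the objective.\<close>

lemma primal_feasible_add_recession: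
  assumes "primal_feasible Q \<Sigma> h"
    and "\<And>W. W \<subseteq> query_vars Q \<Longrightarrow> 0 \<le> g W" "\<And>\<sigma>. \<sigma> \<in> \<Sigma> \<Longrightarrow> stat_form \<sigma> g \<le> 0"
    and "\<And>\<tau>. \<tau> \<in> shannon_ineqs (query_vars Q) \<Longrightarrow> 0 \<le> shannon_form \<tau> g" "g {} = 0"
  shows "primal_feasible Q \<Sigma> (\<lambda>W. h W + g W)"
proof -
  have "stat_form \<sigma> (\<lambda>W. h W + g W) = stat_form \<sigma> h + stat_form \<sigma> g" for \<sigma>
    using linear_formD[OF linear_form_stat_form, of \<sigma> h 1 g] by simp
  moreover have "shannon_form \<tau> (\<lambda>W. h W + g W) = shannon_form \<tau> h + shannon_form \<tau> g" for \<tau>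
    using linear_formD[OF linear_form_shannon_form, of \<tau> h 1 g] by simp
  moreover have "stat_form \<sigma> h + stat_form \<sigma> g \<le> log 2 (stat_b \<sigma>)" if "\<sigma> \<in> \<Sigma>" for \<sigma>
    using assms(1) assms(3)[OF that] that unfolding primal_feasible_def by fastforce
  ultimately show ?thesis
    using assms(1,2,4,5) by (auto simp: primal_feasible_def basic_shannon_def)
qed

text \<open>The coordinate \<open>None\<close> homogenises the linear program.\<close>

lemma strong_duality:
  assumes "finite (query_vars Q)" "finite \<Sigma>" "primal_optimal Q \<Sigma> h"
  shows "\<exists>w s y. dual_feasible Q \<Sigma> w s y \<and> dual_value \<Sigma> w \<le> h (head Q)"
proof -
  let ?X = "query_vars Q"
  let ?S = "shannon_ineqs ?X"
  let ?I = "Pow ?X <+> (\<Sigma> <+> (?S <+> (UNIV :: bool set)))"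
  define M where "M = h (head Q)"
  define a1 where "a1 = (\<lambda>W (x :: 'a set option \<Rightarrow> real). - x (Some W))"
  define a2 where "a2 = (\<lambda>\<sigma> (x :: 'a set option \<Rightarrow> real).
    stat_form \<sigma> (\<lambda>W. x (Some W)) - log 2 (stat_b \<sigma>) * x None)"
  define a3 where "a3 = (\<lambda>\<tau> (x :: 'a set option \<Rightarrow> real). - shannon_form \<tau> (\<lambda>W. x (Some W)))"
  \<comment> \<open>The first form gives one half of the equation for \<open>{}\<close>, the other
    half being the nonnegativity of that variable in \<open>a1\<close>. The second makes the
    homogenising coordinate nonnegative.\<close>
  define a4 where "a4 = (\<lambda>b (x :: 'a set option \<Rightarrow> real). if b then x (Some {}) else - x None)"
  define a where "a = case_sum a1 (case_sum a2 (case_sum a3 a4))"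
  define c where "c = (\<lambda>x :: 'a set option \<Rightarrow> real. x (Some (head Q)) - M * x None)"
  have fin: "finite ?I" using assms finite_shannon_ineqs by auto
  have linc: "linear_form c" by (simp add: c_def linear_form_def algebra_simps)
  have lina: "linear_form (a i)" for i
    by (auto simp: a_def a1_def a2_def a3_def a4_def linear_form_def algebra_simps
        linear_formD[OF linear_form_stat_form] linear_formD[OF linear_form_shannon_form]
        split: sum.split)
  have feas: "primal_feasible Q \<Sigma> h" and
    opt: "\<And>g. primal_feasible Q \<Sigma> g \<Longrightarrow> g (head Q) \<le> M"
    using assms(3) by (auto simp: primal_optimal_def M_def)
  have nonpos: "c x \<le> 0" if x: "\<And>i. i \<in> ?I \<Longrightarrow> a i x \<le> 0" for x
  proof -
    define g where "g = (\<lambda>W. x (Some W))"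
    define t where "t = x None"
    have 1: "0 \<le> g W" if "W \<subseteq> ?X" for W
      using x[of "Inl W"] that by (auto simp: a_def a1_def g_def)
    have 2: "stat_form \<sigma> g \<le> log 2 (stat_b \<sigma>) * t" if "\<sigma> \<in> \<Sigma>" for \<sigma>
      using x[of "Inr (Inl \<sigma>)"] that by (auto simp: a_def a2_def g_def t_def)
    have 3: "0 \<le> shannon_form \<tau> g" if "\<tau> \<in> ?S" for \<tau>
      using x[of "Inr (Inr (Inl \<tau>))"] that by (auto simp: a_def a3_def g_def)
    have 4: "g {} = 0" "0 \<le> t"
      using x[of "Inr (Inr (Inr True))"] x[of "Inr (Inr (Inr False))"] 1[of "{}"]
      by (auto simp: a_def a4_def g_def t_def)
    have "g (head Q) \<le> M * t"
    proof (cases "t = 0")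
      case True
      then have "primal_feasible Q \<Sigma> (\<lambda>W. h W + g W)"
        using primal_feasible_add_recession[OF feas 1 _ 3 4(1)] 2 by simp
      from opt[OF this] True show ?thesis by (simp add: M_def)
    next
      case False
      then have t: "t > 0" using 4 by simp
      have "stat_form \<sigma> (\<lambda>W. inverse t * g W) \<le> log 2 (stat_b \<sigma>)" if "\<sigma> \<in> \<Sigma>" for \<sigma>
      proof -
        have "stat_form \<sigma> (\<lambda>W. inverse t * g W) = inverse t * stat_form \<sigma> g"
          by (rule linear_form_scale[OF linear_form_stat_form])
        also have "\<dots> \<le> inverse t * (log 2 (stat_b \<sigma>) * t)"
          using 2[OF that] t by (intro mult_left_mono) auto
        also have "\<dots> = log 2 (stat_b \<sigma>)" using t by simp
        finally show ?thesis .
      qed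
      moreover have "0 \<le> shannon_form \<tau> (\<lambda>W. inverse t * g W)" if "\<tau> \<in> ?S" for \<tau>
      proof -
        have "shannon_form \<tau> (\<lambda>W. inverse t * g W) = inverse t * shannon_form \<tau> g"
          by (rule linear_form_scale[OF linear_form_shannon_form])
        then show ?thesis using 3[OF that] t by simp
      qed
      ultimately have "primal_feasible Q \<Sigma> (\<lambda>W. inverse t * g W)"
        using 1 4 t by (simp add: primal_feasible_def basic_shannon_def)
      from opt[OF this] t show ?thesis by (simp add: field_simps)
    qed
    then show ?thesis by (simp add: c_def g_def t_def)
  qed
  have "\<exists>l. (\<forall>i\<in>?I. 0 \<le> l i) \<and> (\<forall>x. c x = (\<Sum>i\<in>?I. l i * a i x))"
    by (rule farkas[OF fin linc lina]) (use nonpos in blast)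
  then obtain l where l: "\<forall>i\<in>?I. 0 \<le> l i" "\<And>x. c x = (\<Sum>i\<in>?I. l i * a i x)" by blast
  define w where "w = (\<lambda>\<sigma>. l (Inr (Inl \<sigma>)))"
  define s where "s = (\<lambda>\<tau>. l (Inr (Inr (Inl \<tau>))))"
  define y where "y = l (Inr (Inr (Inr True)))"
  define v where "v = l (Inr (Inr (Inr False)))"
  have nonneg: "0 \<le> w \<sigma>" if "\<sigma> \<in> \<Sigma>" for \<sigma> using l(1) that by (auto simp: w_def)
  have nonneg': "0 \<le> s \<tau>" if "\<tau> \<in> ?S" for \<tau> using l(1) that by (auto simp: s_def)
  have v: "0 \<le> v" using l(1) by (auto simp: v_def)
  have l1: "0 \<le> l (Inl W)" if "W \<subseteq> ?X" for W using l(1) that by auto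
  have expand: "c x = (\<Sum>W\<in>Pow ?X. l (Inl W) * a1 W x) + ((\<Sum>\<sigma>\<in>\<Sigma>. w \<sigma> * a2 \<sigma> x)
     + ((\<Sum>\<tau>\<in>?S. s \<tau> * a3 \<tau> x) + (y * x (Some {}) - v * x None)))" for x
    using assms(1,2) finite_shannon_ineqs[OF assms(1)]
    by (simp add: l(2)[of x] sum.Plus a_def w_def s_def UNIV_bool a4_def y_def v_def)
  have "dual_feasible Q \<Sigma> w s y"
  proof -
    have "coeff_at (\<lambda>h. h (head Q)) W \<le> (\<Sum>\<sigma>\<in>\<Sigma>. w \<sigma> * coeff_at (stat_form \<sigma>) W)
        - (\<Sum>\<tau>\<in>?S. s \<tau> * coeff_at (shannon_form \<tau>) W) + y * coeff_at (\<lambda>h. h {}) W"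
      if W: "W \<subseteq> ?X" for W
    proof -
      \<comment> \<open>At the unit vector of \<open>W\<close> the identity becomes the dual
        constraint of \<open>W\<close>, with the multiplier \<open>l (Inl W)\<close> as its
        slack.\<close>
      define x :: "'a set option \<Rightarrow> real" where "x = (\<lambda>k. case k of None \<Rightarrow> 0 | Some U \<Rightarrow> of_bool (U = W))"
      have "(\<Sum>U\<in>Pow ?X. l (Inl U) * a1 U x) \<le> 0"
        using l1 by (intro sum_nonpos) (auto simp: a1_def x_def)
      then show ?thesis using expand[of x]
        by (simp add: c_def a2_def a3_def x_def coeff_at_def sum_negf)
    qed
    then show ?thesis using nonneg nonneg' by (simp add: dual_feasible_def)
  qed
  \<comment> \<open>At the unit vector of \<open>None\<close> the identity reads
    \<open>- M = - dual_value \<Sigma> w - v\<close>.\<close>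
  moreover have "dual_value \<Sigma> w \<le> M"
    using expand[of "\<lambda>k. of_bool (k = None)"] v
    by (simp add: c_def a1_def a2_def a3_def dual_value_def sum_negf
        linear_form_zero[OF linear_form_stat_form] linear_form_zero[OF linear_form_shannon_form])
  ultimately show ?thesis by (auto simp: M_def)
qed

section \<open>A dual solution as a certificate for the information inequality\<close>

lemma sum_Pow_of_bool:
  assumes "finite X" "U \<subseteq> X"
  shows "(\<Sum>W\<in>Pow X. g W * of_bool (U = W)) = (g U :: real)"
proof -
  have "(\<Sum>W\<in>Pow X. g W * of_bool (U = W)) = (\<Sum>W\<in>Pow X. if U = W then g W else 0)"
    by (intro sum.cong) auto
  then show ?thesis using assms by (simp add: sum.delta)
qed

lemma stat_form_expand:
  assumes "finite X" "stat_U \<sigma> \<subseteq> X" "stat_V \<sigma> \<subseteq> X"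
  shows "stat_form \<sigma> g = (\<Sum>W\<in>Pow X. g W * coeff_at (stat_form \<sigma>) W)"
proof -
  \<comment> \<open>The two indicators are kept apart because both hit the same \<open>W\<close> if
    \<open>stat_V \<sigma>\<close> lies in \<open>stat_U \<sigma>\<close>.\<close>
  have coeff: "g W * coeff_at (stat_form \<sigma>) W
      = (real_of_ereal (1 / stat_p \<sigma>) - 1) * (g W * of_bool (stat_U \<sigma> = W))
        + g W * of_bool (stat_U \<sigma> \<union> stat_V \<sigma> = W)" for W
    by (simp add: stat_form_def cond_def coeff_at_def algebra_simps)
  show ?thesis unfolding coeff sum.distrib sum_distrib_left[symmetric]
    using assms by (simp add: sum_Pow_of_bool stat_form_def cond_def algebra_simps)
qed

lemma shannon_form_expand:
  assumes "finite X" "\<tau> \<in> shannon_ineqs X"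
  shows "shannon_form \<tau> g = (\<Sum>W\<in>Pow X. g W * coeff_at (shannon_form \<tau>) W)"
proof (cases \<tau>)
  case (Mono U V)
  then have "U \<subseteq> X" "U \<union> V \<subseteq> X" using assms(2) by (auto simp: shannon_ineqs_def)
  then show ?thesis using assms(1) Mono
    by (simp add: coeff_at_def right_diff_distrib sum_subtractf sum_Pow_of_bool)
next
  case (Submod U V)
  then have "U \<subseteq> X" "V \<subseteq> X" "U \<union> V \<subseteq> X" "U \<inter> V \<subseteq> X"
    using assms(2) by (auto simp: shannon_ineqs_def)
  then show ?thesis using assms(1) Submod
    by (simp add: coeff_at_def distrib_left right_diff_distrib sum.distrib sum_subtractf
        sum_Pow_of_bool)
qed

text \<open>Multiply the dual constraint of each \<open>W\<close> by \<open>g W \<ge> 0\<close> and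
  add up; exchanging the sums reassembles the forms from their coefficients. The term of the free
  multiplier \<open>y\<close> vanishes because \<open>g {} = 0\<close>.\<close>

lemma dual_feasible_certificate:
  assumes "finite (query_vars Q)" "\<And>\<sigma>. \<sigma> \<in> \<Sigma> \<Longrightarrow> stat_U \<sigma> \<union> stat_V \<sigma> \<subseteq> query_vars Q"
    and "head Q \<subseteq> query_vars Q" "dual_feasible Q \<Sigma> w s y"
    and "\<And>U. U \<subseteq> query_vars Q \<Longrightarrow> 0 \<le> g U" "g {} = 0"
  shows "(\<Sum>\<tau>\<in>shannon_ineqs (query_vars Q). s \<tau> * shannon_form \<tau> g)
    \<le> (\<Sum>\<sigma>\<in>\<Sigma>. w \<sigma> * stat_form \<sigma> g) - g (head Q)"
proof -
  let ?X = "query_vars Q"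
  let ?S = "shannon_ineqs ?X"
  have stat: "(\<Sum>\<sigma>\<in>\<Sigma>. w \<sigma> * stat_form \<sigma> g)
      = (\<Sum>W\<in>Pow ?X. g W * (\<Sum>\<sigma>\<in>\<Sigma>. w \<sigma> * coeff_at (stat_form \<sigma>) W))"
  proof -
    have "(\<Sum>\<sigma>\<in>\<Sigma>. w \<sigma> * stat_form \<sigma> g)
        = (\<Sum>\<sigma>\<in>\<Sigma>. \<Sum>W\<in>Pow ?X. w \<sigma> * (g W * coeff_at (stat_form \<sigma>) W))"
      using assms(1,2)
      by (intro sum.cong refl) (simp add: stat_form_expand[of ?X] sum_distrib_left)
    also have "\<dots> = (\<Sum>W\<in>Pow ?X. \<Sum>\<sigma>\<in>\<Sigma>. w \<sigma> * (g W * coeff_at (stat_form \<sigma>) W))"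
      by (rule sum.swap)
    finally show ?thesis by (simp add: sum_distrib_left mult.left_commute)
  qed
  have shannon: "(\<Sum>\<tau>\<in>?S. s \<tau> * shannon_form \<tau> g)
      = (\<Sum>W\<in>Pow ?X. g W * (\<Sum>\<tau>\<in>?S. s \<tau> * coeff_at (shannon_form \<tau>) W))"
  proof -
    have "(\<Sum>\<tau>\<in>?S. s \<tau> * shannon_form \<tau> g)
        = (\<Sum>\<tau>\<in>?S. \<Sum>W\<in>Pow ?X. s \<tau> * (g W * coeff_at (shannon_form \<tau>) W))"
      using assms(1)
      by (intro sum.cong refl) (simp add: shannon_form_expand[of ?X] sum_distrib_left)
    also have "\<dots> = (\<Sum>W\<in>Pow ?X. \<Sum>\<tau>\<in>?S. s \<tau> * (g W * coeff_at (shannon_form \<tau>) W))"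
      by (rule sum.swap)
    finally show ?thesis by (simp add: sum_distrib_left mult.left_commute)
  qed
  have y: "g W * (y * coeff_at (\<lambda>h. h {}) W) = 0" for W
    using assms(6) by (auto simp: coeff_at_def)
  have "g (head Q) = (\<Sum>W\<in>Pow ?X. g W * coeff_at (\<lambda>h. h (head Q)) W)"
    using assms(1,3) by (simp add: coeff_at_def sum_Pow_of_bool)
  also have "\<dots> \<le> (\<Sum>W\<in>Pow ?X. g W * ((\<Sum>\<sigma>\<in>\<Sigma>. w \<sigma> * coeff_at (stat_form \<sigma>) W)
      - (\<Sum>\<tau>\<in>?S. s \<tau> * coeff_at (shannon_form \<tau>) W) + y * coeff_at (\<lambda>h. h {}) W))"
    using assms(4,5) by (intro sum_mono mult_left_mono) (auto simp: dual_feasible_def)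
  also have "\<dots> = (\<Sum>W\<in>Pow ?X. g W * (\<Sum>\<sigma>\<in>\<Sigma>. w \<sigma> * coeff_at (stat_form \<sigma>) W))
      - (\<Sum>W\<in>Pow ?X. g W * (\<Sum>\<tau>\<in>?S. s \<tau> * coeff_at (shannon_form \<tau>) W))"
    by (simp add: distrib_left right_diff_distrib y sum_subtractf)
  finally show ?thesis unfolding stat shannon by simp
qed

lemma basic_shannon_mono:
  assumes "basic_shannon X h" "U \<subseteq> V" "V \<subseteq> X"
  shows "h U \<le> h V"
proof -
  have "Mono U V \<in> shannon_ineqs X" using assms by (auto simp: shannon_ineqs_def)
  then have "0 \<le> shannon_form (Mono U V) h" using assms(1) unfolding basic_shannon_def by blast
  then show ?thesis using assms(2) by (simp add: Un_absorb1)
qed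

lemma basic_shannon_submod:
  assumes "basic_shannon X h" "U \<subseteq> X" "V \<subseteq> X"
  shows "h (U \<union> V) + h (U \<inter> V) \<le> h U + h V"
proof -
  have "Submod U V \<in> shannon_ineqs X" using assms by (auto simp: shannon_ineqs_def)
  then have "0 \<le> shannon_form (Submod U V) h" using assms(1) unfolding basic_shannon_def by blast
  then show ?thesis by simp
qed

lemma basic_shannonI:
  assumes "h {} = 0" "\<And>U V. U \<subseteq> V \<Longrightarrow> V \<subseteq> X \<Longrightarrow> h U \<le> h V"
    and "\<And>U V. U \<subseteq> X \<Longrightarrow> V \<subseteq> X \<Longrightarrow> h (U \<union> V) + h (U \<inter> V) \<le> h U + h V"
  shows "basic_shannon X h"
proof -
  have "h U \<le> h (U \<union> V)" if "U \<subseteq> X" "V \<subseteq> X" for U V using assms(2)[of U "U \<union> V"] that by simp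
  moreover have "0 \<le> h U + h V - h (U \<union> V) - h (U \<inter> V)" if "U \<subseteq> X" "V \<subseteq> X" for U V
    using assms(3)[OF that] by simp
  ultimately show ?thesis using assms(1) by (auto simp: basic_shannon_def shannon_ineqs_def)
qed

lemma dual_feasible_bound:
  assumes "finite (query_vars Q)" "\<And>\<sigma>. \<sigma> \<in> \<Sigma> \<Longrightarrow> stat_U \<sigma> \<union> stat_V \<sigma> \<subseteq> query_vars Q"
    and "head Q \<subseteq> query_vars Q" "dual_feasible Q \<Sigma> w s y" "basic_shannon (query_vars Q) g"
  shows "g (head Q) \<le> (\<Sum>\<sigma>\<in>\<Sigma>. w \<sigma> * stat_form \<sigma> g)"
proof -
  have g0: "g {} = 0" using assms(5) by (simp add: basic_shannon_def)
  have "0 \<le> g U" if "U \<subseteq> query_vars Q" for U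
    using basic_shannon_mono[OF assms(5), of "{}" U] that g0 by simp
  then have "(\<Sum>\<tau>\<in>shannon_ineqs (query_vars Q). s \<tau> * shannon_form \<tau> g)
      \<le> (\<Sum>\<sigma>\<in>\<Sigma>. w \<sigma> * stat_form \<sigma> g) - g (head Q)"
    using assms(1-4) g0 by (intro dual_feasible_certificate) auto
  moreover have "0 \<le> (\<Sum>\<tau>\<in>shannon_ineqs (query_vars Q). s \<tau> * shannon_form \<tau> g)"
    using assms(4,5) by (intro sum_nonneg mult_nonneg_nonneg)
      (auto simp: dual_feasible_def basic_shannon_def)
  ultimately show ?thesis by simp
qed

section \<open>Entropy of the uniform distribution on a set of tuples\<close>

text \<open>Dividing by the size of the fibre makes every fibre count exactly once.\<close>

lemma sum_over_fibres:
  fixes g :: "'b \<Rightarrow> real"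
  assumes "finite A"
  shows "(\<Sum>t\<in>A. g (f t) / real (card {t'\<in>A. f t' = f t})) = (\<Sum>u\<in>f ` A. g u)"
proof -
  have "(\<Sum>t\<in>A. g (f t) / real (card {t'\<in>A. f t' = f t}))
      = (\<Sum>u\<in>f ` A. \<Sum>t\<in>{t\<in>A. f t = u}. g (f t) / real (card {t'\<in>A. f t' = f t}))"
    using assms by (rule sum.image_gen)
  also have "\<dots> = (\<Sum>u\<in>f ` A. g u)"
  proof (rule sum.cong[OF refl])
    fix u assume "u \<in> f ` A"
    then have "card {t'\<in>A. f t' = u} \<noteq> 0" using assms by auto
    then show "(\<Sum>t\<in>{t\<in>A. f t = u}. g (f t) / real (card {t'\<in>A. f t' = f t})) = g u"
      by simp
  qed
  finally show ?thesis .
qed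

text \<open>The tangent at 1 takes the place of Jensen's inequality in all entropy estimates
  below.\<close>

lemma log2_le_diff: "0 < x \<Longrightarrow> log 2 x \<le> (x - 1) / ln (2 :: real)"
  using ln_le_minus_one[of x] by (simp add: log_def divide_right_mono)

definition fibre :: "('v, 'd) relation \<Rightarrow> 'v set \<Rightarrow> ('v \<rightharpoonup> 'd) \<Rightarrow> ('v, 'd) relation" where
  "fibre T U t = {t'\<in>T. t' |` U = t |` U}"

text \<open>Shannon entropy of the marginal on \<open>U\<close>: a tuple has marginal probability
  \<open>card (fibre T U t) / card T\<close>, and averaging over tuples instead of marginal values
  supplies the probabilities as weights. For empty \<open>T\<close> the value is 0.\<close>

definition entropy :: "('v, 'd) relation \<Rightarrow> 'v set \<Rightarrow> real" where
  "entropy T U = (\<Sum>t\<in>T. log 2 (real (card T) / real (card (fibre T U t)))) / real (card T)"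

lemma restrict_map_eq_iff: "s |` U = t |` U \<longleftrightarrow> (\<forall>x\<in>U. s x = t x)"
  by (auto simp: restrict_map_def fun_eq_iff)

lemma fibre_antimono: "U \<subseteq> V \<Longrightarrow> fibre T V t \<subseteq> fibre T U t"
  by (auto simp: fibre_def restrict_map_eq_iff)

lemma card_fibre_pos: "finite T \<Longrightarrow> t \<in> T \<Longrightarrow> 0 < card (fibre T U t)"
  by (auto simp: fibre_def card_gt_0_iff)

lemma entropy_empty: "entropy T {} = 0"
proof -
  have "fibre T {} t = T" for t by (auto simp: fibre_def)
  then show ?thesis by (simp add: entropy_def)
qed

lemma entropy_inj_on:
  assumes "finite T" "T \<noteq> {}" "inj_on (\<lambda>t. t |` U) T"
  shows "entropy T U = log 2 (real (card T))"
proof -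
  have "fibre T U t = {t}" if "t \<in> T" for t using assms(3) that by (auto simp: fibre_def inj_on_def)
  then show ?thesis using assms(1,2) by (simp add: entropy_def)
qed

lemma entropy_mono:
  assumes "finite T" "U \<subseteq> V"
  shows "entropy T U \<le> entropy T V"
proof -
  have "log 2 (real (card T) / real (card (fibre T U t))) \<le> log 2 (real (card T) / real (card (fibre T V t)))"
    if "t \<in> T" for t
  proof -
    have "card (fibre T V t) \<le> card (fibre T U t)"
      using assms fibre_antimono[OF assms(2)] by (intro card_mono) (simp_all add: fibre_def)
    moreover have "0 < card T" using that assms(1) by (auto simp: card_gt_0_iff)
    ultimately show ?thesis using card_fibre_pos[OF assms(1) that]
      by (simp add: frac_le)
  qed
  then show ?thesis by (simp add: entropy_def sum_mono divide_right_mono)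
qed

text \<open>The last hypothesis makes \<open>A\<close> a union of fibres over \<open>W\<close>, and
  the weights inside each of them add up to 1.\<close>

lemma sum_inverse_card_fibre:
  assumes "finite T" "A \<subseteq> T" "\<And>t t'. t \<in> A \<Longrightarrow> t' \<in> fibre T W t \<Longrightarrow> t' \<in> A"
  shows "(\<Sum>t\<in>A. 1 / real (card (fibre T W t))) = real (card ((\<lambda>t. t |` W) ` A))"
proof -
  have "fibre T W t = {t'\<in>A. t' |` W = t |` W}" if "t \<in> A" for t
    using assms(2,3) that by (auto simp: fibre_def)
  then show ?thesis
    using sum_over_fibres[of A "\<lambda>_. 1" "\<lambda>t. t |` W"] assms(1,2) finite_subset[of A T] by simp
qed

text \<open>Double counting of the pairs \<open>a\<close>, \<open>t\<close> that agree on
  \<open>U\<close>. It turns a fibre size in a numerator into an inner sum over a fibre.\<close>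

lemma sum_swap_fibre:
  fixes g :: "('v \<rightharpoonup> 'd) \<Rightarrow> real"
  assumes "finite T"
  shows "(\<Sum>t\<in>T. real (card (fibre T U t)) * g t) = (\<Sum>a\<in>T. \<Sum>t\<in>fibre T U a. g t)"
proof -
  have "(\<Sum>t\<in>T. real (card (fibre T U t)) * g t) = (\<Sum>t\<in>T. \<Sum>a\<in>{a\<in>T. a |` U = t |` U}. g t)"
    by (simp add: fibre_def)
  also have "\<dots> = (\<Sum>a\<in>T. \<Sum>t\<in>{t\<in>T. a |` U = t |` U}. g t)"
    using assms assms by (rule sum.swap_restrict)
  also have "\<dots> = (\<Sum>a\<in>T. \<Sum>t\<in>fibre T U a. g t)"
    by (simp add: fibre_def eq_commute)
  finally show ?thesis .
qed

text \<open>The difference of the two sides is a conditional mutual information, hence a relative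
  entropy. Concretely, in the ratio
  \<open>c U t * c V t / (c (U \<union> V) t * c (U \<inter> V) t)\<close> the numerator counts
  pairs \<open>a\<close>, \<open>b\<close> that agree with \<open>t\<close> on \<open>U\<close> and
  on \<open>V\<close>, respectively; for fixed \<open>a\<close> the sum over \<open>t\<close> and
  \<open>b\<close> is at most 1.\<close>

lemma entropy_submod:
  assumes "finite T"
  shows "entropy T (U \<union> V) + entropy T (U \<inter> V) \<le> entropy T U + entropy T V"
proof (cases "T = {}")
  case True
  then show ?thesis by (simp add: entropy_def)
next
  case False
  define N where "N = real (card T)"
  define c where "c = (\<lambda>W t. real (card (fibre T W t)))"
  have N: "0 < N" using False assms by (simp add: N_def card_gt_0_iff)
  have c: "0 < c W t" if "t \<in> T" for W t using card_fibre_pos[OF assms that] by (simp add: c_def)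
  have "(\<Sum>t\<in>T. c U t * c V t / (c (U \<union> V) t * c (U \<inter> V) t))
      = (\<Sum>a\<in>T. \<Sum>t\<in>fibre T U a. c V t / (c (U \<union> V) t * c (U \<inter> V) t))"
    using sum_swap_fibre[OF assms, of U "\<lambda>t. c V t / (c (U \<union> V) t * c (U \<inter> V) t)"]
    by (simp add: c_def)
  also have "\<dots> \<le> (\<Sum>a\<in>T. 1)"
  proof (rule sum_mono)
    fix a assume a: "a \<in> T"
    have "(\<Sum>t\<in>fibre T U a. c V t / (c (U \<union> V) t * c (U \<inter> V) t))
        = (\<Sum>t\<in>fibre T U a. \<Sum>b\<in>{b\<in>T. b |` V = t |` V}. 1 / (c (U \<union> V) t * c (U \<inter> V) a))"
    proof (rule sum.cong[OF refl])
      fix t assume t: "t \<in> fibre T U a"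
      have "fibre T (U \<inter> V) t = fibre T (U \<inter> V) a"
        using t by (auto simp: fibre_def restrict_map_eq_iff)
      then show "c V t / (c (U \<union> V) t * c (U \<inter> V) t)
          = (\<Sum>b\<in>{b\<in>T. b |` V = t |` V}. 1 / (c (U \<union> V) t * c (U \<inter> V) a))"
        by (simp add: c_def fibre_def)
    qed
    also have "\<dots> = (\<Sum>b\<in>T. \<Sum>t\<in>{t\<in>fibre T U a. b |` V = t |` V}. 1 / (c (U \<union> V) t * c (U \<inter> V) a))"
      using assms by (intro sum.swap_restrict) (auto simp: fibre_def)
    also have "\<dots> \<le> (\<Sum>b\<in>T. of_bool (b \<in> fibre T (U \<inter> V) a) / c (U \<inter> V) a)"
    proof (rule sum_mono)
      fix b assume b: "b \<in> T"
      let ?A = "{t\<in>fibre T U a. b |` V = t |` V}"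
      have "(\<Sum>t\<in>?A. 1 / (c (U \<union> V) t * c (U \<inter> V) a)) = (\<Sum>t\<in>?A. 1 / c (U \<union> V) t) / c (U \<inter> V) a"
        by (simp add: sum_divide_distrib)
      also have "(\<Sum>t\<in>?A. 1 / c (U \<union> V) t) = real (card ((\<lambda>t. t |` (U \<union> V)) ` ?A))"
        unfolding c_def using assms
        by (intro sum_inverse_card_fibre) (auto simp: fibre_def restrict_map_eq_iff)
      \<comment> \<open>\<open>a\<close> determines \<open>t\<close> on \<open>U\<close> and
        \<open>b\<close> determines it on \<open>V\<close>, so at most one restriction to
        \<open>U \<union> V\<close> occurs, and if one occurs then \<open>a\<close> and
        \<open>b\<close> agree on \<open>U \<inter> V\<close>.\<close>
      also have "card ((\<lambda>t. t |` (U \<union> V)) ` ?A) \<le> of_bool (b \<in> fibre T (U \<inter> V) a)"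
      proof (cases "?A = {}")
        case False
        then obtain t0 where t0: "t0 \<in> ?A" by blast
        then have "b \<in> fibre T (U \<inter> V) a" using b by (auto simp: fibre_def restrict_map_eq_iff)
        moreover have "(\<lambda>t. t |` (U \<union> V)) ` ?A \<subseteq> {t0 |` (U \<union> V)}"
          using t0 by (auto simp: fibre_def restrict_map_eq_iff)
        then have "card ((\<lambda>t. t |` (U \<union> V)) ` ?A) \<le> 1"
          using card_mono[of "{t0 |` (U \<union> V)}"] by simp
        ultimately show ?thesis by simp
      next
        case True
        show ?thesis unfolding True by simp
      qed
      finally show "(\<Sum>t\<in>?A. 1 / (c (U \<union> V) t * c (U \<inter> V) a))
          \<le> of_bool (b \<in> fibre T (U \<inter> V) a) / c (U \<inter> V) a"
        using c[OF a] by (simp add: divide_right_mono order_less_imp_le)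
    qed
    also have "\<dots> = 1"
    proof -
      have "(\<Sum>b\<in>T. of_bool (b \<in> fibre T (U \<inter> V) a)) = c (U \<inter> V) a"
      proof -
        have "T \<inter> {b. b \<in> fibre T (U \<inter> V) a} = fibre T (U \<inter> V) a" by (auto simp: fibre_def)
        then show ?thesis using assms by (simp add: c_def sum_of_bool_eq)
      qed
      then show ?thesis using c[OF a, of "U \<inter> V"] by (simp flip: sum_divide_distrib)
    qed
    finally show "(\<Sum>t\<in>fibre T U a. c V t / (c (U \<union> V) t * c (U \<inter> V) t)) \<le> 1" .
  qed
  finally have key: "(\<Sum>t\<in>T. c U t * c V t / (c (U \<union> V) t * c (U \<inter> V) t) - 1) \<le> 0"
    by (simp add: sum_subtractf)
  have "N * (entropy T (U \<union> V) + entropy T (U \<inter> V) - entropy T U - entropy T V)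
      = (\<Sum>t\<in>T. log 2 (N / c (U \<union> V) t) + log 2 (N / c (U \<inter> V) t) - log 2 (N / c U t) - log 2 (N / c V t))"
    using N by (simp add: entropy_def N_def c_def algebra_simps sum.distrib sum_subtractf)
  also have "\<dots> = (\<Sum>t\<in>T. log 2 (c U t * c V t / (c (U \<union> V) t * c (U \<inter> V) t)))"
    using N c by (intro sum.cong refl) (simp add: log_divide_pos log_mult_pos)
  also have "\<dots> \<le> (\<Sum>t\<in>T. (c U t * c V t / (c (U \<union> V) t * c (U \<inter> V) t) - 1) / ln 2)"
    using c by (intro sum_mono log2_le_diff) simp
  also have "\<dots> \<le> 0" using key by (simp add: divide_nonpos_pos flip: sum_divide_distrib)
  finally show ?thesis using N by (simp add: mult_le_0_iff)
qed

lemma basic_shannon_entropy: "finite T \<Longrightarrow> basic_shannon X (entropy T)"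
  by (intro basic_shannonI) (auto simp: entropy_empty entropy_mono entropy_submod)

section \<open>Degree sequences and their norms\<close>

definition tuple_degree :: "('v, 'd) relation \<Rightarrow> 'v set \<Rightarrow> 'v set \<Rightarrow> ('v \<rightharpoonup> 'd) \<Rightarrow> nat" where
  "tuple_degree R V U u = card {t \<in> project (U \<union> V) R. t |` U = u}"

lemma finite_project: "finite R \<Longrightarrow> finite (project U R)"
  by (simp add: project_def)

lemma set_deg_seq:
  assumes "finite R"
  shows "set (deg_seq R V U) = tuple_degree R V U ` project U R"
  using finite_project[OF assms] by (simp add: deg_seq_def tuple_degree_def)

lemma sum_list_deg_seq:
  fixes f :: "nat \<Rightarrow> real"
  shows "(\<Sum>x\<leftarrow>deg_seq R V U. f x) = (\<Sum>u\<in>project U R. f (tuple_degree R V U u))"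
proof -
  let ?M = "image_mset (tuple_degree R V U) (mset_set (project U R))"
  have "deg_seq R V U = rev (sorted_list_of_multiset ?M)"
    unfolding deg_seq_def tuple_degree_def[abs_def] ..
  then have "(\<Sum>x\<leftarrow>deg_seq R V U. f x) = (\<Sum>x\<leftarrow>sorted_list_of_multiset ?M. f x)"
    by (simp add: rev_map[symmetric] sum_list_rev)
  also have "\<dots> = (\<Sum>x\<in>#mset (sorted_list_of_multiset ?M). f x)"
    by (simp flip: sum_mset_sum_list)
  also have "\<dots> = (\<Sum>u\<in>project U R. f (tuple_degree R V U u))"
    by (simp add: image_mset.compositionality sum_unfold_sum_mset o_def)
  finally show ?thesis .
qed

lemma lp_norm_deg_seq_infinity:
  "finite R \<Longrightarrow> lp_norm \<infinity> (deg_seq R V U) = real (Max (insert 0 (tuple_degree R V U ` project U R)))"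
  by (simp add: lp_norm_def set_deg_seq)

lemma lp_norm_deg_seq_real:
  "lp_norm (ereal p) (deg_seq R V U) = (\<Sum>u\<in>project U R. real (tuple_degree R V U u) powr p) powr (1 / p)"
  by (simp add: lp_norm_def sum_list_deg_seq)

lemma tuple_degree_pos:
  assumes "finite R" "u \<in> project U R"
  shows "0 < tuple_degree R V U u"
proof -
  obtain t where t: "t \<in> R" "u = t |` U" using assms(2) by (auto simp: project_def)
  then have "t |` (U \<union> V) \<in> {t \<in> project (U \<union> V) R. t |` U = u}"
    by (auto simp: project_def restrict_restrict Int_absorb1)
  moreover have "finite {t \<in> project (U \<union> V) R. t |` U = u}" using finite_project[OF assms(1)] by simp
  ultimately show ?thesis unfolding tuple_degree_def by (auto simp: card_gt_0_iff)
qed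

lemma ereal_pos_cases:
  assumes "0 < (p :: ereal)"
  obtains (infinity) "p = \<infinity>" | (finite) q where "p = ereal q" "0 < q"
  using assms by (cases p) auto

lemma real_of_ereal_one_divide: "0 < q \<Longrightarrow> real_of_ereal (1 / ereal q) = 1 / q"
  by (simp add: divide_ereal_def inverse_eq_divide)

lemma lp_norm_deg_seq_pos:
  assumes "finite R" "R \<noteq> {}" "0 < p"
  shows "0 < lp_norm p (deg_seq R V U)"
proof -
  obtain u where u: "u \<in> project U R" using assms(2) by (auto simp: project_def)
  note fin = finite_project[OF assms(1), of U]
  show ?thesis using assms(3)
  proof (cases rule: ereal_pos_cases)
    case infinity
    have "tuple_degree R V U u \<le> Max (insert 0 (tuple_degree R V U ` project U R))"
      using fin u by (intro Max_ge) auto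
    then show ?thesis using tuple_degree_pos[OF assms(1) u, of V]
      by (simp add: infinity lp_norm_deg_seq_infinity[OF assms(1)])
  next
    case (finite q)
    have "0 < (\<Sum>u\<in>project U R. real (tuple_degree R V U u) powr q)"
      using fin u tuple_degree_pos[OF assms(1)] by (intro sum_pos) fastforce+
    then show ?thesis by (simp add: finite lp_norm_deg_seq_real)
  qed
qed

section \<open>Entropy against the norms of degree sequences\<close>

text \<open>Conditional entropy is the mean entropy of \<open>V\<close> inside the fibres over
  \<open>U\<close>, each at most the logarithm of the number of values there. The bound
  \<open>d\<close> is abstract because it will be a degree in a relation that may contain more than
  the projections of \<open>T\<close>.\<close>

lemma cond_entropy_le:
  assumes "finite T" "T \<noteq> {}" "\<And>a. a \<in> T \<Longrightarrow> 0 < d a"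
    and "\<And>a t. a \<in> T \<Longrightarrow> t \<in> fibre T U a \<Longrightarrow> d t = d a"
    and "\<And>a. a \<in> T \<Longrightarrow> real (card ((\<lambda>t. t |` (U \<union> V)) ` fibre T U a)) \<le> d a"
  shows "cond (entropy T) V U \<le> (\<Sum>t\<in>T. log 2 (d t)) / real (card T)"
proof -
  define N where "N = real (card T)"
  define c where "c = (\<lambda>W t. real (card (fibre T W t)))"
  have N: "0 < N" using assms by (simp add: N_def card_gt_0_iff)
  have c: "0 < c W t" if "t \<in> T" for W t using card_fibre_pos[OF assms(1) that] by (simp add: c_def)
  have "(\<Sum>t\<in>T. c U t / (c (U \<union> V) t * d t)) = (\<Sum>a\<in>T. \<Sum>t\<in>fibre T U a. 1 / (c (U \<union> V) t * d t))"
    using sum_swap_fibre[OF assms(1), of U "\<lambda>t. 1 / (c (U \<union> V) t * d t)"] by (simp add: c_def)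
  also have "\<dots> \<le> (\<Sum>a\<in>T. 1)"
  proof (rule sum_mono)
    fix a assume a: "a \<in> T"
    have "(\<Sum>t\<in>fibre T U a. 1 / (c (U \<union> V) t * d t)) = (\<Sum>t\<in>fibre T U a. 1 / c (U \<union> V) t / d a)"
      using assms(4)[OF a] by (intro sum.cong) auto
    also have "\<dots> = (\<Sum>t\<in>fibre T U a. 1 / c (U \<union> V) t) / d a"
      by (simp add: sum_divide_distrib)
    also have "(\<Sum>t\<in>fibre T U a. 1 / c (U \<union> V) t) = real (card ((\<lambda>t. t |` (U \<union> V)) ` fibre T U a))"
      unfolding c_def using assms(1)
      by (intro sum_inverse_card_fibre) (auto simp: fibre_def restrict_map_eq_iff)
    finally show "(\<Sum>t\<in>fibre T U a. 1 / (c (U \<union> V) t * d t)) \<le> 1"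
      using assms(3,5)[OF a] by simp
  qed
  finally have key: "(\<Sum>t\<in>T. c U t / (c (U \<union> V) t * d t) - 1) \<le> 0" by (simp add: sum_subtractf)
  have "N * cond (entropy T) V U - (\<Sum>t\<in>T. log 2 (d t))
      = (\<Sum>t\<in>T. log 2 (N / c (U \<union> V) t) - log 2 (N / c U t) - log 2 (d t))"
    using N by (simp add: cond_def entropy_def N_def c_def algebra_simps sum.distrib sum_subtractf)
  also have "\<dots> = (\<Sum>t\<in>T. log 2 (c U t / (c (U \<union> V) t * d t)))"
    using N c assms(3) by (intro sum.cong refl) (simp add: log_divide_pos log_mult_pos)
  also have "\<dots> \<le> (\<Sum>t\<in>T. (c U t / (c (U \<union> V) t * d t) - 1) / ln 2)"
    using c assms(3) by (intro sum_mono log2_le_diff) simp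
  also have "\<dots> \<le> 0" using key by (simp add: divide_nonpos_pos flip: sum_divide_distrib)
  finally show ?thesis using N by (simp add: field_simps N_def)
qed

text \<open>For \<open>p = \<infinity>\<close>, a mean of logarithms of degrees is at most the
  logarithm of the maximal degree. For finite \<open>q\<close>, the claim multiplied by
  \<open>q\<close> is Gibbs' inequality: with probability \<open>c U t / N\<close> for the value of
  \<open>t\<close> on \<open>U\<close>, the mean of the logarithm of \<open>d t powr q\<close>
  divided by that probability is at most the logarithm of the sum of all \<open>q\<close>-th powers
  of degrees.\<close>

lemma entropy_stat_form_le:
  assumes "finite T" "T \<noteq> {}" "finite R" "(\<lambda>t. t |` A) ` T \<subseteq> R"
    and "U \<subseteq> A" "V \<subseteq> A" "0 < p"
  shows "real_of_ereal (1 / p) * entropy T U + cond (entropy T) V U \<le> log 2 (lp_norm p (deg_seq R V U))"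
proof -
  define N where "N = real (card T)"
  define c where "c = (\<lambda>W t. real (card (fibre T W t)))"
  define d where "d = (\<lambda>t. real (tuple_degree R V U (t |` U)))"
  have N: "0 < N" using assms by (simp add: N_def card_gt_0_iff)
  have c: "0 < c W t" if "t \<in> T" for W t using card_fibre_pos[OF assms(1) that] by (simp add: c_def)
  have proj: "t |` W \<in> project W R" if "t \<in> T" "W \<subseteq> A" for t W
  proof -
    have "t |` W = (t |` A) |` W" using that(2) by (simp add: Int_absorb1)
    moreover have "t |` A \<in> R" using that(1) assms(4) by blast
    ultimately show ?thesis unfolding project_def by (rule image_eqI)
  qed
  have d: "0 < d t" if "t \<in> T" for t
    using tuple_degree_pos[OF assms(3) proj[OF that assms(5)]] by (simp add: d_def)
  have cond: "cond (entropy T) V U \<le> (\<Sum>t\<in>T. log 2 (d t)) / N"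
    unfolding N_def
  proof (rule cond_entropy_le[OF assms(1,2) d])
    fix a assume a: "a \<in> T"
    show "d t = d a" if "t \<in> fibre T U a" for t using that by (simp add: d_def fibre_def)
    have "(\<lambda>t. t |` (U \<union> V)) ` fibre T U a \<subseteq> {t \<in> project (U \<union> V) R. t |` U = a |` U}"
      using proj[of _ "U \<union> V"] assms(5,6)
      by (auto simp: fibre_def restrict_restrict Int_absorb1)
    then show "real (card ((\<lambda>t. t |` (U \<union> V)) ` fibre T U a)) \<le> d a"
      using finite_project[OF assms(3)] by (simp add: d_def tuple_degree_def card_mono)
  qed
  show ?thesis using assms(7)
  proof (cases rule: ereal_pos_cases)
    case infinity
    define M where "M = real (Max (insert 0 (tuple_degree R V U ` project U R)))"
    have "d t \<le> M" if "t \<in> T" for t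
      unfolding d_def M_def using proj[OF that assms(5)] finite_project[OF assms(3)]
      by (intro of_nat_mono Max_ge) auto
    then have "(\<Sum>t\<in>T. log 2 (d t)) \<le> (\<Sum>t\<in>T. log 2 M)"
      using d by (intro sum_mono) fastforce
    also have "\<dots> = N * log 2 M" by (simp add: N_def)
    finally have "(\<Sum>t\<in>T. log 2 (d t)) / N \<le> log 2 M" using N by (simp add: field_simps)
    then show ?thesis using cond
      by (simp add: infinity lp_norm_deg_seq_infinity[OF assms(3)] M_def)
  next
    case (finite q)
    define S where "S = (\<Sum>u\<in>project U R. real (tuple_degree R V U u) powr q)"
    have sub: "(\<lambda>t. t |` U) ` T \<subseteq> project U R" using proj[OF _ assms(5)] by auto
    obtain t0 where "t0 \<in> T" using assms(2) by blast
    then have S: "0 < S" unfolding S_def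
      using finite_project[OF assms(3)] proj[OF \<open>t0 \<in> T\<close> assms(5)] tuple_degree_pos[OF assms(3)]
      by (intro sum_pos) fastforce+
    have "(\<Sum>t\<in>T. d t powr q / c U t) = (\<Sum>u\<in>(\<lambda>t. t |` U) ` T. real (tuple_degree R V U u) powr q)"
      using sum_over_fibres[OF assms(1), of "\<lambda>u. real (tuple_degree R V U u) powr q" "\<lambda>t. t |` U"]
      by (simp add: c_def d_def fibre_def)
    \<comment> \<open>\<open>R\<close> may have values on \<open>U\<close> that no tuple of
      \<open>T\<close> attains.\<close>
    also have "\<dots> \<le> S" unfolding S_def using sub finite_project[OF assms(3)]
      by (intro sum_mono2) auto
    finally have "N / S * (\<Sum>t\<in>T. d t powr q / c U t) \<le> N / S * S"
      using N S by (intro mult_left_mono) auto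
    moreover have "N / S * (\<Sum>t\<in>T. d t powr q / c U t) = (\<Sum>t\<in>T. N * d t powr q / (c U t * S))"
      by (simp add: sum_distrib_left mult.commute)
    ultimately have key: "(\<Sum>t\<in>T. N * d t powr q / (c U t * S) - 1) \<le> 0"
      using S by (simp add: sum_subtractf N_def)
    have "N * entropy T U = (\<Sum>t\<in>T. log 2 (N / c U t))"
      using N by (simp add: entropy_def N_def c_def)
    then have "N * entropy T U + q * (\<Sum>t\<in>T. log 2 (d t)) - N * log 2 S
        = (\<Sum>t\<in>T. log 2 (N / c U t) + q * log 2 (d t) - log 2 S)"
      by (simp add: N_def sum.distrib sum_subtractf sum_distrib_left)
    also have "\<dots> = (\<Sum>t\<in>T. log 2 (N * d t powr q / (c U t * S)))"
    proof (rule sum.cong[OF refl])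
      fix t assume "t \<in> T"
      then have "0 < c U t" "0 < d t" "0 < d t powr q" using c[of t U] d[of t] by auto
      then show "log 2 (N / c U t) + q * log 2 (d t) - log 2 S = log 2 (N * d t powr q / (c U t * S))"
        using N S by (simp add: log_divide_pos log_mult_pos log_powr)
    qed
    also have "\<dots> \<le> (\<Sum>t\<in>T. (N * d t powr q / (c U t * S) - 1) / ln 2)"
    proof (intro sum_mono log2_le_diff)
      fix t assume "t \<in> T"
      then have "0 < c U t" "0 < d t powr q" using c[of t U] d[of t] by auto
      then show "0 < N * d t powr q / (c U t * S)" using N S by simp
    qed
    also have "\<dots> \<le> 0" using key by (simp add: divide_nonpos_pos flip: sum_divide_distrib)
    finally have "entropy T U + q * ((\<Sum>t\<in>T. log 2 (d t)) / N) \<le> log 2 S"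
      using N by (simp add: field_simps)
    moreover have "q * cond (entropy T) V U \<le> q * ((\<Sum>t\<in>T. log 2 (d t)) / N)"
      using cond finite(2) by (intro mult_left_mono) auto
    ultimately have "entropy T U + q * cond (entropy T) V U \<le> log 2 S" by linarith
    then have "1 / q * (entropy T U + q * cond (entropy T) V U) \<le> 1 / q * log 2 S"
      using finite(2) by (intro mult_left_mono) auto
    moreover have "log 2 (lp_norm p (deg_seq R V U)) = 1 / q * log 2 S"
      using S by (simp add: finite(1) lp_norm_deg_seq_real log_powr flip: S_def)
    ultimately show ?thesis using finite(2)
      by (simp add: finite(1) real_of_ereal_one_divide distrib_left)
  qed
qed

lemma prod_powr_eq_powr_sum:
  fixes b w :: "'a \<Rightarrow> real"
  assumes "finite S" "\<And>x. x \<in> S \<Longrightarrow> 0 < b x"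
  shows "(\<Prod>x\<in>S. b x powr w x) = 2 powr (\<Sum>x\<in>S. w x * log 2 (b x))"
proof -
  have "b x powr w x = 2 powr (w x * log 2 (b x))" if "x \<in> S" for x
  proof -
    have "2 powr (w x * log 2 (b x)) = (2 powr log 2 (b x)) powr w x"
      by (simp add: powr_powr mult.commute)
    then show ?thesis using assms(2)[OF that] by simp
  qed
  then show ?thesis using assms(1) by (simp add: powr_sum)
qed

lemma query_result_le_norm_product:
  fixes D :: "nat \<Rightarrow> ('v, 'd) relation"
  assumes "finite (query_vars Q)" "head Q \<subseteq> query_vars Q" "finite \<Sigma>"
    and stats: "\<And>\<sigma>. \<sigma> \<in> \<Sigma> \<Longrightarrow> simple_statistic Q \<sigma>"
    and dual: "dual_feasible Q \<Sigma> w s y" and D: "database Q D"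
  shows "real (card (query_result Q D)) \<le> norm_product \<Sigma> w D"
proof (cases "card (query_result Q D) = 0")
  case True
  then show ?thesis by (simp add: norm_product_def prod_nonneg)
next
  \<comment> \<open>Now every relation named in a statistic is nonempty, so all norms are positive
    and have meaningful logarithms; the default \<open>0 powr 0 = 0\<close> cannot
    interfere.\<close>
  case False
  obtain T where T: "T \<subseteq> natural_join Q D" "inj_on (\<lambda>t. t |` head Q) T"
      "query_result Q D = (\<lambda>t. t |` head Q) ` T"
    using subset_image_inj[of "query_result Q D" "\<lambda>t. t |` head Q" "natural_join Q D"]
    by (auto simp: query_result_def project_def)
  have card_T: "card (query_result Q D) = card T" using T by (simp add: card_image)
  then have fin: "finite T" "T \<noteq> {}" using False by (auto intro: card_ge_0_finite)
  have attrs: "attrs Q j \<subseteq> query_vars Q" if "j \<in> {1..natoms Q}" for j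
    using that by (auto simp: query_vars_def)
  have stat: "stat_form \<sigma> (entropy T) \<le> log 2 (stat_norm D \<sigma>) \<and> 0 < stat_norm D \<sigma>"
    if "\<sigma> \<in> \<Sigma>" for \<sigma>
  proof -
    define j where "j = stat_rel \<sigma>"
    have j: "j \<in> {1..natoms Q}" "stat_U \<sigma> \<subseteq> attrs Q j" "stat_V \<sigma> \<subseteq> attrs Q j" "0 < stat_p \<sigma>"
      using stats[OF that] by (auto simp: simple_statistic_def j_def)
    have R: "finite (D j)" "(\<lambda>t. t |` attrs Q j) ` T \<subseteq> D j"
      using D j(1) T(1) by (auto simp: database_def natural_join_def)
    then have "D j \<noteq> {}" using fin(2) by auto
    then show ?thesis
      using lp_norm_deg_seq_pos[OF R(1) _ j(4)] entropy_stat_form_le[OF fin R j(2-4)]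
      by (simp add: stat_form_def stat_norm_def j_def)
  qed
  have "log 2 (real (card T)) = entropy T (head Q)"
    using entropy_inj_on[OF fin T(2)] by simp
  also have "\<dots> \<le> (\<Sum>\<sigma>\<in>\<Sigma>. w \<sigma> * stat_form \<sigma> (entropy T))"
  proof (rule dual_feasible_bound[OF assms(1) _ assms(2) dual basic_shannon_entropy[OF fin(1)]])
    show "stat_U \<sigma> \<union> stat_V \<sigma> \<subseteq> query_vars Q" if "\<sigma> \<in> \<Sigma>" for \<sigma>
      using stats[OF that] attrs by (fastforce simp: simple_statistic_def)
  qed
  also have "\<dots> \<le> (\<Sum>\<sigma>\<in>\<Sigma>. w \<sigma> * log 2 (stat_norm D \<sigma>))"
    using stat dual by (intro sum_mono mult_left_mono) (auto simp: dual_feasible_def)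
  finally have "2 powr log 2 (real (card T)) \<le> 2 powr (\<Sum>\<sigma>\<in>\<Sigma>. w \<sigma> * log 2 (stat_norm D \<sigma>))"
    by simp
  then show ?thesis using fin stat prod_powr_eq_powr_sum[OF assms(3), of "stat_norm D" w]
    by (simp add: card_T norm_product_def card_gt_0_iff)
qed

section \<open>Domination by normal functions\<close>

definition meeting :: "'v set \<Rightarrow> 'v set \<Rightarrow> 'v set set" where
  "meeting X S = {W \<in> Pow X. W \<inter> S \<noteq> {}}"

text \<open>These are the weighted coverage functions, also called normal polymatroids:
  \<open>g S\<close> is the joint entropy of the attributes in \<open>S\<close> if there are
  independent variables of entropy \<open>l W\<close>, one for each \<open>W\<close>, and attribute
  \<open>x\<close> shows those with \<open>x \<in> W\<close>.\<close>

definition normal :: "'v set \<Rightarrow> ('v set \<Rightarrow> real) \<Rightarrow> bool" where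
  "normal X g \<longleftrightarrow> (\<exists>l. (\<forall>W\<in>Pow X. 0 \<le> l W) \<and> (\<forall>S\<subseteq>X. g S = sum l (meeting X S)))"

lemma finite_meeting: "finite X \<Longrightarrow> finite (meeting X S)"
  by (simp add: meeting_def)

lemma meeting_mono: "S \<subseteq> S' \<Longrightarrow> meeting X S \<subseteq> meeting X S'"
  by (auto simp: meeting_def)

lemma normal_empty: "normal X g \<Longrightarrow> g {} = 0"
  by (auto simp: normal_def meeting_def)

lemma normal_mono:
  assumes "finite X" "normal X g" "S \<subseteq> S'" "S' \<subseteq> X"
  shows "g S \<le> g S'"
proof -
  obtain l where l: "\<forall>W\<in>Pow X. 0 \<le> l W" "\<forall>S\<subseteq>X. g S = sum l (meeting X S)"
    using assms(2) by (auto simp: normal_def)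
  have "sum l (meeting X S) \<le> sum l (meeting X S')"
    using assms l(1) meeting_mono[OF assms(3)] by (intro sum_mono2 finite_meeting) (auto simp: meeting_def)
  then show ?thesis using l(2) assms(3,4) by simp
qed

lemma normal_add:
  assumes "normal X f" "normal X g"
  shows "normal X (\<lambda>S. f S + g S)"
proof -
  obtain k where k: "\<forall>W\<in>Pow X. 0 \<le> k W" "\<forall>S\<subseteq>X. f S = sum k (meeting X S)"
    using assms(1) by (auto simp: normal_def)
  obtain l where l: "\<forall>W\<in>Pow X. 0 \<le> l W" "\<forall>S\<subseteq>X. g S = sum l (meeting X S)"
    using assms(2) by (auto simp: normal_def)
  show ?thesis unfolding normal_def
    using k l by (intro exI[of _ "\<lambda>W. k W + l W"]) (simp add: sum.distrib)
qed

lemma normal_step: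
  assumes "finite X" "P \<subseteq> X" "0 \<le> m"
  shows "normal X (\<lambda>S. m * of_bool (P \<inter> S \<noteq> {}))"
  unfolding normal_def
  using assms finite_meeting[OF assms(1)]
  by (intro exI[of _ "\<lambda>W. if W = P then m else 0"]) (auto simp: meeting_def)

lemma normal_cong:
  assumes "normal X f" "\<And>S. S \<subseteq> X \<Longrightarrow> f S = g S"
  shows "normal X g"
  using assms by (auto simp: normal_def)

text \<open>Peel off layers: lowering \<open>a\<close> by its least positive value \<open>m\<close>
  on its support \<open>P\<close> lowers the maximum by \<open>m\<close> exactly on the sets that
  meet \<open>P\<close>, which is \<open>m\<close> times a step function, and shrinks the
  support.\<close>

lemma normal_Max:
  fixes a :: "'v \<Rightarrow> real"
  assumes "finite X" "\<And>x. x \<in> X \<Longrightarrow> 0 \<le> a x"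
  shows "normal X (\<lambda>S. Max (insert 0 (a ` S)))"
  using assms(2)
proof (induction "card {x\<in>X. 0 < a x}" arbitrary: a rule: less_induct)
  case less
  define P where "P = {x\<in>X. 0 < a x}"
  have P: "P \<subseteq> X" "finite P" using assms(1) by (auto simp: P_def)
  have off: "a x = 0" if "x \<in> X" "x \<notin> P" for x using less.prems that by (force simp: P_def)
  show ?case
  proof (cases "P = {}")
    case True
    have "Max (insert 0 (a ` S)) = 0" if "S \<subseteq> X" for S
    proof -
      have "insert 0 (a ` S) = {0}" using off True that by auto
      then show ?thesis by (simp only: Max_singleton)
    qed
    then show ?thesis using normal_step[OF assms(1), of "{}" 0] by (auto elim: normal_cong)
  next
    case False
    define m where "m = Min (a ` P)"
    define a' where "a' = (\<lambda>x. if x \<in> P then a x - m else 0)"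
    have "m \<in> a ` P" unfolding m_def using P False by (intro Min_in) auto
    then obtain x0 where x0: "x0 \<in> P" "m = a x0" by blast
    then have m: "0 < m" by (simp add: P_def)
    have m_le: "m \<le> a x" if "x \<in> P" for x using P that by (simp add: m_def)
    have a': "0 \<le> a' x" for x using m_le by (simp add: a'_def)
    have "{x\<in>X. 0 < a' x} \<subset> P" using x0 m by (auto simp: a'_def)
    then have "card {x\<in>X. 0 < a' x} < card {x\<in>X. 0 < a x}"
      using psubset_card_mono[OF P(2)] by (simp add: P_def)
    from less.hyps[OF this a'] have IH: "normal X (\<lambda>S. Max (insert 0 (a' ` S)))" .
    have max_eq: "Max (insert 0 (a' ` S)) + m * of_bool (P \<inter> S \<noteq> {}) = Max (insert 0 (a ` S))"
      if S: "S \<subseteq> X" for S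
    proof -
      have fin: "finite S" using S assms(1) finite_subset by blast
      show ?thesis
      proof (cases "P \<inter> S = {}")
        case True
        have "a' ` S = a ` S" using True S off by (intro image_cong refl) (auto simp: a'_def)
        then show ?thesis using True by simp
      next
        case False
        then obtain x1 where x1: "x1 \<in> P" "x1 \<in> S" by blast
        let ?M = "Max (insert 0 (a' ` S))"
        have le: "a' x \<le> ?M" if "x \<in> S" for x using fin that by (intro Max_ge) auto
        have "0 \<le> ?M" using fin by (intro Max_ge) auto
        have "Max (insert 0 (a ` S)) = ?M + m"
        proof (rule Max_eqI)
          show "finite (insert 0 (a ` S))" using fin by simp
          show "y \<le> ?M + m" if "y \<in> insert 0 (a ` S)" for y
          proof -
            have "a x \<le> a' x + m" if "x \<in> S" for x
              using off[of x] S that m by (cases "x \<in> P") (auto simp: a'_def)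
            then show ?thesis using that le \<open>0 \<le> ?M\<close> m by fastforce
          qed
          have "?M \<in> insert 0 (a' ` S)" using fin by (intro Max_in) auto
          \<comment> \<open>Off \<open>P\<close> the function \<open>a'\<close> is 0, so a maximum
            attained there, or equal to the inserted 0, is attained at \<open>x1\<close> as well. A
            maximiser in \<open>P\<close> is needed because \<open>a = a' + m\<close> only on
            \<open>P\<close>.\<close>
          then have "\<exists>y\<in>P \<inter> S. ?M = a' y"
          proof
            assume "?M = 0"
            then have "a' x1 = ?M" using le[OF x1(2)] a'[of x1] by simp
            then show ?thesis using x1 by force
          next
            assume "?M \<in> a' ` S"
            then obtain y where y: "y \<in> S" "?M = a' y" by blast
            show ?thesis
            proof (cases "y \<in> P")
              case True
              then show ?thesis using y by blast
            next
              case False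
              then have "a' x1 = ?M" using y le[OF x1(2)] a'[of x1] by (simp add: a'_def)
              then show ?thesis using x1 by force
            qed
          qed
          then obtain y where "y \<in> P" "y \<in> S" "?M = a' y" by blast
          then have "?M + m = a y" by (simp add: a'_def)
          then show "?M + m \<in> insert 0 (a ` S)" using \<open>y \<in> S\<close> by simp
        qed
        then show ?thesis using False by simp
      qed
    qed
    have "normal X (\<lambda>S. Max (insert 0 (a' ` S)) + m * of_bool (P \<inter> S \<noteq> {}))"
      using IH normal_step[OF assms(1) P(1)] m by (intro normal_add) auto
    then show ?thesis by (rule normal_cong) (rule max_eq)
  qed
qed

text \<open>Induction on \<open>V\<close>: for \<open>n \<in> V\<close> split \<open>h\<close> into the conditional part \<open>h(\<cdot>|n)\<close>, handled by the
  induction hypothesis, and the mutual information with \<open>n\<close>, which is replaced by the maximum of its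
  values on singletons.\<close>

lemma exists_normal_below:
  assumes "finite X" "basic_shannon X h" "V \<subseteq> X"
  shows "\<exists>g. normal X g \<and> (\<forall>S\<subseteq>X. g S \<le> h S) \<and> (\<forall>x\<in>X. g {x} = h {x}) \<and> h V \<le> g V"
proof -
  have "finite V" using assms(1,3) finite_subset by blast
  then show ?thesis using assms(2,3)
  proof (induction V arbitrary: h rule: finite_induct)
    case empty
    \<comment> \<open>As \<open>h {} = 0\<close>, only the singletons have to be matched, and by
      monotonicity the maximum of their values stays below \<open>h\<close>.\<close>
    define a where "a = (\<lambda>x. h {x})"
    note mono = basic_shannon_mono[OF empty.prems(1)]
    have h0: "h {} = 0" using empty.prems(1) by (simp add: basic_shannon_def)
    have a: "0 \<le> a x" if "x \<in> X" for x using mono[of "{}" "{x}"] that h0 by (simp add: a_def)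
    have "Max (insert 0 (a ` S)) \<le> h S" if "S \<subseteq> X" for S
    proof -
      have "finite S" using that assms(1) finite_subset by blast
      moreover have "0 \<le> h S" using mono[of "{}" S] that h0 by simp
      moreover have "a x \<le> h S" if "x \<in> S" for x using mono[of "{x}" S] that \<open>S \<subseteq> X\<close> by (simp add: a_def)
      ultimately show ?thesis by auto
    qed
    moreover have "Max (insert 0 (a ` {x})) = h {x}" if "x \<in> X" for x using a[OF that] by (simp add: a_def)
    ultimately show ?case using normal_Max[OF assms(1) a] h0 by (intro exI[of _ "\<lambda>S. Max (insert 0 (a ` S))"]) auto
  next
    case (insert n V)
    note mono = basic_shannon_mono[OF insert.prems(1)] and submod = basic_shannon_submod[OF insert.prems(1)]
    have h0: "h {} = 0" using insert.prems(1) by (simp add: basic_shannon_def)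
    have n: "n \<in> X" and V: "V \<subseteq> X" using insert.prems(2) by auto
    define h2 where "h2 = (\<lambda>S. h (insert n S) - h {n})"
    define a where "a = (\<lambda>x. h {x} + h {n} - h {x, n})"
    have "basic_shannon X h2"
    proof (rule basic_shannonI)
      show "h2 {} = 0" by (simp add: h2_def)
      show "h2 U \<le> h2 W" if "U \<subseteq> W" "W \<subseteq> X" for U W
        using mono[of "insert n U" "insert n W"] that n by (auto simp: h2_def)
      show "h2 (U \<union> W) + h2 (U \<inter> W) \<le> h2 U + h2 W" if "U \<subseteq> X" "W \<subseteq> X" for U W
        using submod[of "insert n U" "insert n W"] that n by (simp add: h2_def)
    qed
    from insert.IH[OF this V] obtain g2 where g2: "normal X g2" "\<And>S. S \<subseteq> X \<Longrightarrow> g2 S \<le> h2 S"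
      "\<And>x. x \<in> X \<Longrightarrow> g2 {x} = h2 {x}" "h2 V \<le> g2 V" by blast
    have a: "0 \<le> a x" if "x \<in> X" for x
    proof -
      have "{x} \<inter> {n} \<subseteq> X" using n by blast
      then have "0 \<le> h ({x} \<inter> {n})" using mono[of "{}" "{x} \<inter> {n}"] h0 by simp
      then show ?thesis using submod[of "{x}" "{n}"] that n by (simp add: a_def insert_commute)
    qed
    define g where "g = (\<lambda>S. g2 S + Max (insert 0 (a ` S)))"
    have "normal X g" unfolding g_def by (intro normal_add g2(1) normal_Max assms(1) a)
    moreover have "g S \<le> h S" if S: "S \<subseteq> X" for S
    proof -
      \<comment> \<open>Mutual information with \<open>n\<close> does not decrease from
        \<open>{x}\<close> to \<open>S\<close>. The intersection \<open>S \<inter> {x, n}\<close>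
        contains \<open>x\<close>, also when \<open>n \<in> S\<close>, so monotonicity finishes the
        estimate.\<close>
      have "a x \<le> h S + h {n} - h (insert n S)" if x: "x \<in> S" for x
      proof -
        have "S \<union> {x, n} = insert n S" using x by blast
        then have "h (insert n S) + h (S \<inter> {x, n}) \<le> h S + h {x, n}"
          using submod[of S "{x, n}"] S x n by auto
        moreover have "h {x} \<le> h (S \<inter> {x, n})" using mono[of "{x}" "S \<inter> {x, n}"] S x by auto
        ultimately show ?thesis by (simp add: a_def)
      qed
      moreover have "0 \<le> h S + h {n} - h (insert n S)"
      proof -
        have "S \<inter> {n} \<subseteq> X" using n by blast
        then have "0 \<le> h (S \<inter> {n})" using mono[of "{}" "S \<inter> {n}"] h0 by simp
        then show ?thesis using submod[of S "{n}"] S n by simp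
      qed
      moreover have "finite S" using S assms(1) finite_subset by blast
      ultimately have "Max (insert 0 (a ` S)) \<le> h S + h {n} - h (insert n S)" by auto
      then show ?thesis using g2(2)[OF S] by (simp add: g_def h2_def)
    qed
    moreover have "g {x} = h {x}" if "x \<in> X" for x
      using g2(3)[OF that] a[OF that] by (simp add: g_def h2_def a_def insert_commute)
    moreover have "h (insert n V) \<le> g (insert n V)"
    proof -
      \<comment> \<open>The maximum over \<open>insert n V\<close> includes \<open>a n\<close>,
        which restores the term \<open>h {n}\<close> subtracted in \<open>h2\<close>.\<close>
      have "h {n} = a n" by (simp add: a_def)
      also have "\<dots> \<le> Max (insert 0 (a ` insert n V))" using insert.hyps(1) by (intro Max_ge) auto
      finally have "h {n} \<le> Max (insert 0 (a ` insert n V))" .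
      moreover have "g2 V \<le> g2 (insert n V)"
        by (rule normal_mono[OF assms(1) g2(1) subset_insertI insert.prems(2)])
      ultimately show ?thesis using g2(4) unfolding g_def h2_def by linarith
    qed
    ultimately show ?case by blast
  qed
qed

text \<open>The coefficient \<open>1 / p - 1\<close> of the value at \<open>stat_U \<sigma>\<close>
  is negative for \<open>p > 1\<close>, so equality is required there, and
  \<open>card (stat_U \<sigma>) \<le> 1\<close> provides it. The value at the union has coefficient
  1 and may decrease.\<close>

lemma stat_form_mono_simple:
  assumes "simple_statistic Q \<sigma>" "finite (attrs Q (stat_rel \<sigma>))" "attrs Q (stat_rel \<sigma>) \<subseteq> X"
    and "g {} = h {}" "\<And>x. x \<in> X \<Longrightarrow> g {x} = h {x}" "\<And>S. S \<subseteq> X \<Longrightarrow> g S \<le> h S"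
  shows "stat_form \<sigma> g \<le> stat_form \<sigma> h"
proof -
  have sub: "stat_U \<sigma> \<subseteq> X" "stat_V \<sigma> \<subseteq> X" "finite (stat_U \<sigma>)" "card (stat_U \<sigma>) \<le> 1"
    using assms(1-3) finite_subset by (auto simp: simple_statistic_def)
  have "g (stat_U \<sigma>) = h (stat_U \<sigma>)"
  proof (cases "stat_U \<sigma> = {}")
    case False
    then have "card (stat_U \<sigma>) = 1" using sub by (simp add: card_gt_0_iff order_antisym Suc_leI)
    then obtain x where "stat_U \<sigma> = {x}" by (auto simp: card_1_singleton_iff)
    then show ?thesis using assms(5) sub(1) by simp
  qed (use assms(4) in simp)
  then show ?thesis using assms(6)[of "stat_U \<sigma> \<union> stat_V \<sigma>"] sub(1,2)
    by (simp add: stat_form_def cond_def)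
qed

section \<open>Databases realising rounded normal functions\<close>

lemma card_image_le_if_factors:
  assumes "finite A" "\<And>x y. x \<in> A \<Longrightarrow> y \<in> A \<Longrightarrow> g x = g y \<Longrightarrow> f x = f y"
  shows "card (f ` A) \<le> card (g ` A)"
proof -
  have "f ` A \<subseteq> (\<lambda>z. f (inv_into A g z)) ` g ` A"
  proof
    fix y assume "y \<in> f ` A"
    then obtain x where x: "x \<in> A" "y = f x" by blast
    then have "y = f (inv_into A g (g x))"
      using assms(2)[of "inv_into A g (g x)" x] by (simp add: f_inv_into_f inv_into_into)
    then show "y \<in> (\<lambda>z. f (inv_into A g z)) ` g ` A" using x(1) by blast
  qed
  then show ?thesis using assms(1) by (meson card_image_le card_mono finite_imageI order_trans)
qed

definition codes :: "'v set \<Rightarrow> ('v set \<Rightarrow> nat) \<Rightarrow> ('v set \<Rightarrow> nat) set" where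
  "codes X N = PiE (Pow X) (\<lambda>W. {..<N W})"

lemma finite_codes: "finite X \<Longrightarrow> finite (codes X N)"
  by (simp add: codes_def finite_PiE)

lemma card_restrict_codes:
  assumes "finite X" "M \<subseteq> Pow X" "A \<subseteq> codes X N"
  shows "card ((\<lambda>z. restrict z M) ` A) \<le> (\<Prod>W\<in>M. N W)"
proof -
  have fin: "finite M" using finite_subset[OF assms(2)] assms(1) by simp
  have "(\<lambda>z. restrict z M) ` A \<subseteq> PiE M (\<lambda>W. {..<N W})"
  proof (rule image_subsetI)
    fix z assume "z \<in> A"
    then have "z \<in> PiE (Pow X) (\<lambda>W. {..<N W})" using assms(3) by (auto simp: codes_def)
    then show "restrict z M \<in> PiE M (\<lambda>W. {..<N W})"
      unfolding restrict_PiE_iff using assms(2) PiE_mem by blast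
  qed
  moreover have "finite (PiE M (\<lambda>W. {..<N W}))" using fin by (simp add: finite_PiE)
  ultimately have "card ((\<lambda>z. restrict z M) ` A) \<le> card (PiE M (\<lambda>W. {..<N W}))" by (intro card_mono)
  then show ?thesis using fin by (simp add: card_PiE)
qed

lemma card_restrict_all_codes:
  assumes "finite X" "M \<subseteq> Pow X" "\<And>W. W \<subseteq> X \<Longrightarrow> 1 \<le> N W"
  shows "(\<Prod>W\<in>M. N W) \<le> card ((\<lambda>z. restrict z M) ` codes X N)"
proof -
  have fin: "finite M" using finite_subset[OF assms(2)] assms(1) by simp
  have "PiE M (\<lambda>W. {..<N W}) \<subseteq> (\<lambda>z. restrict z M) ` codes X N"
  proof
    fix f assume f: "f \<in> PiE M (\<lambda>W. {..<N W})"
    \<comment> \<open>A partial code is extended by 0, an admissible value since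
      \<open>1 \<le> N W\<close>.\<close>
    define z where "z = restrict (\<lambda>W. if W \<in> M then f W else 0) (Pow X)"
    have "(if W \<in> M then f W else 0) \<in> {..<N W}" if "W \<in> Pow X" for W
      using PiE_mem[OF f, of W] assms(3)[of W] that by auto
    then have "z \<in> codes X N" unfolding codes_def z_def restrict_PiE_iff by blast
    moreover have "f = restrict z M"
    proof
      fix W
      show "f W = restrict z M W"
        using PiE_arb[OF f, of W] assms(2) by (cases "W \<in> M") (auto simp: z_def)
    qed
    ultimately show "f \<in> (\<lambda>z. restrict z M) ` codes X N" by blast
  qed
  then have "card (PiE M (\<lambda>W. {..<N W})) \<le> card ((\<lambda>z. restrict z M) ` codes X N)"
    using finite_codes[OF assms(1)] by (intro card_mono finite_imageI)
  then show ?thesis using fin by (simp add: card_PiE)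
qed

text \<open>Attribute \<open>x\<close> of the tuple of \<open>z\<close> stores the coordinates \<open>z W\<close> with \<open>x \<in> W\<close>.\<close>

lemma exists_tuples:
  assumes "finite X"
  shows "\<exists>tup :: ('v set \<Rightarrow> nat) \<Rightarrow> ('v \<rightharpoonup> nat). (\<forall>z. dom (tup z) = X) \<and>
    (\<forall>S\<subseteq>X. \<forall>z\<in>codes X N. \<forall>z'\<in>codes X N.
      tup z |` S = tup z' |` S \<longleftrightarrow> (\<forall>W\<in>meeting X S. z W = z' W))"
proof -
  \<comment> \<open>The finite set of all possible attribute values, to be encoded injectively as
    natural numbers.\<close>
  define C where "C = (\<lambda>(x, z). restrict z (meeting X {x})) ` (X \<times> codes X N)"
  have "countable C" using assms finite_codes unfolding C_def by (intro countable_finite) auto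
  then have inj: "inj_on (to_nat_on C) C" by (rule inj_on_to_nat_on)
  define tup where "tup = (\<lambda>z x. if x \<in> X then Some (to_nat_on C (restrict z (meeting X {x}))) else None)"
  have "tup z |` S = tup z' |` S \<longleftrightarrow> (\<forall>W\<in>meeting X S. z W = z' W)"
    if "S \<subseteq> X" "z \<in> codes X N" "z' \<in> codes X N" for S z z'
  proof -
    have "tup z x = tup z' x \<longleftrightarrow> (\<forall>W\<in>meeting X {x}. z W = z' W)" if x: "x \<in> S" for x
    proof -
      have "restrict z (meeting X {x}) \<in> C" "restrict z' (meeting X {x}) \<in> C"
        using x \<open>S \<subseteq> X\<close> \<open>z \<in> codes X N\<close> \<open>z' \<in> codes X N\<close> unfolding C_def
        by (auto intro: image_eqI[of _ _ "(x, z)"] image_eqI[of _ _ "(x, z')"])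
      then have "tup z x = tup z' x \<longleftrightarrow> restrict z (meeting X {x}) = restrict z' (meeting X {x})"
        using inj_on_eq_iff[OF inj] x \<open>S \<subseteq> X\<close> by (auto simp: tup_def)
      also have "\<dots> \<longleftrightarrow> (\<forall>W\<in>meeting X {x}. z W = z' W)"
        by (auto simp: restrict_def fun_eq_iff)
      finally show ?thesis .
    qed
    then show ?thesis by (auto simp: restrict_map_eq_iff meeting_def)
  qed
  moreover have "dom (tup z) = X" for z by (auto simp: tup_def dom_def)
  ultimately show ?thesis by blast
qed

text \<open>Each query variable belongs to an atom, so every value of a join tuple occurs in a
  relation. Finiteness matters because \<open>card\<close> is 0 on infinite sets, which would spoil
  a lower bound on the result.\<close>

lemma finite_natural_join:
  assumes "finite (query_vars Q)" "database Q D" "\<And>j. j \<in> {1..natoms Q} \<Longrightarrow> finite (attrs Q j)"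
  shows "finite (natural_join Q D)"
proof -
  define R where "R = (\<Union>j\<in>{1..natoms Q}. \<Union>t\<in>D j. ran t)"
  have "finite (ran t)" if "j \<in> {1..natoms Q}" "t \<in> D j" for j t
    using assms(2,3) that by (intro finite_ran) (auto simp: database_def)
  then have "finite R" using assms(2) by (auto simp: R_def database_def)
  have "natural_join Q D \<subseteq> {t. dom t = query_vars Q \<and> ran t \<subseteq> R}"
  proof
    fix t assume t: "t \<in> natural_join Q D"
    have "y \<in> R" if "y \<in> ran t" for y
    proof -
      obtain x where x: "t x = Some y" using \<open>y \<in> ran t\<close> by (auto simp: ran_def)
      then have "x \<in> query_vars Q" using t by (auto simp: natural_join_def)
      then obtain j where j: "j \<in> {1..natoms Q}" "x \<in> attrs Q j" by (auto simp: query_vars_def)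
      then have "t |` attrs Q j \<in> D j" "(t |` attrs Q j) x = Some y"
        using t x by (auto simp: natural_join_def)
      then show ?thesis using j(1) unfolding R_def by (blast intro: ranI)
    qed
    then show "t \<in> {t. dom t = query_vars Q \<and> ran t \<subseteq> R}" using t by (auto simp: natural_join_def)
  qed
  then show ?thesis using finite_set_of_finite_maps[OF assms(1) \<open>finite R\<close>] finite_subset by blast
qed

text \<open>At most \<open>K\<close> entries, each at most \<open>L\<close>, give a norm of at most
  \<open>K powr (1 / p) * L\<close>. The logarithmic hypothesis has the shape of a statistics
  constraint with \<open>log 2 K\<close> and \<open>log 2 L\<close> as the unconditional and the
  conditional term.\<close>

lemma lp_norm_deg_seq_le:
  assumes "finite R" "0 < p" "card (project U R) \<le> K" "\<And>u. u \<in> project U R \<Longrightarrow> tuple_degree R V U u \<le> L"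
    and "1 \<le> K" "1 \<le> L" "0 < b"
    and "real_of_ereal (1 / p) * log 2 (real K) + log 2 (real L) \<le> log 2 b"
  shows "lp_norm p (deg_seq R V U) \<le> b"
  using assms(2)
proof (cases rule: ereal_pos_cases)
  case infinity
  have "Max (insert 0 (tuple_degree R V U ` project U R)) \<le> L"
    using finite_project[OF assms(1)] assms(4) by auto
  moreover have "real L \<le> b" using assms(5-8) by (simp add: infinity)
  ultimately show ?thesis by (simp add: infinity lp_norm_deg_seq_infinity[OF assms(1)])
next
  case (finite q)
  have "(\<Sum>u\<in>project U R. real (tuple_degree R V U u) powr q) \<le> (\<Sum>u\<in>project U R. real L powr q)"
    using assms(4) finite(2) by (intro sum_mono powr_mono2) auto
  also have "\<dots> \<le> real K * real L powr q" using assms(3) by (simp add: mult_right_mono)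
  finally have "lp_norm p (deg_seq R V U) \<le> (real K * real L powr q) powr (1 / q)"
    unfolding finite(1) lp_norm_deg_seq_real using finite(2)
    by (intro powr_mono2 sum_nonneg) auto
  also have "\<dots> = real K powr (1 / q) * real L"
    using finite(2) by (simp add: powr_mult powr_powr)
  also have "\<dots> = 2 powr (1 / q * log 2 (real K) + log 2 (real L))"
  proof -
    have "2 powr (1 / q * log 2 (real K)) = (2 powr log 2 (real K)) powr (1 / q)"
      by (simp add: powr_powr)
    then show ?thesis using assms(5,6) by (simp add: powr_add)
  qed
  also have "\<dots> \<le> 2 powr log 2 b" using assms(8) finite(2)
    by (intro powr_mono) (auto simp: finite(1) real_of_ereal_one_divide)
  finally show ?thesis using assms(7) by simp
qed

lemma log_prod_le_sum:
  assumes "finite M" "\<And>W. W \<in> M \<Longrightarrow> 1 \<le> N W" "\<And>W. W \<in> M \<Longrightarrow> real (N W) \<le> 2 powr l W"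
  shows "log 2 (real (\<Prod>W\<in>M. N W)) \<le> sum l M"
proof -
  have "real (\<Prod>W\<in>M. N W) \<le> (\<Prod>W\<in>M. 2 powr l W)"
    using assms by (simp add: prod_mono)
  also have "\<dots> = 2 powr sum l M" using assms(1) by (simp add: powr_sum)
  finally have le: "real (\<Prod>W\<in>M. N W) \<le> 2 powr sum l M" .
  have "0 < (\<Prod>W\<in>M. N W)" using assms(2) by (intro prod_pos) (force simp: Suc_le_eq)
  then have "log 2 (real (\<Prod>W\<in>M. N W)) \<le> log 2 (2 powr sum l M)"
    using le by (intro log_mono) (simp_all del: of_nat_prod)
  then show ?thesis by simp
qed

lemma exists_database_of_normal:
  assumes "wf_query Q" "normal (query_vars Q) g"
    and "\<And>\<sigma>. \<sigma> \<in> \<Sigma> \<Longrightarrow> simple_statistic Q \<sigma>" "\<And>\<sigma>. \<sigma> \<in> \<Sigma> \<Longrightarrow> stat_form \<sigma> g \<le> log 2 (stat_b \<sigma>)"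
  shows "\<exists>D :: nat \<Rightarrow> ('v, nat) relation. database Q D \<and> satisfies D \<Sigma> \<and>
    2 powr g (head Q) / 2 ^ 2 ^ card (query_vars Q) \<le> real (card (query_result Q D))"
proof -
  define X where "X = query_vars Q"
  have finA: "finite (attrs Q j)" and subA: "attrs Q j \<subseteq> X" if "j \<in> {1..natoms Q}" for j
    using assms(1) that by (auto simp: wf_query_def X_def query_vars_def)
  have finX: "finite X" using assms(1) by (auto simp: wf_query_def X_def query_vars_def)
  have headX: "head Q \<subseteq> X" using assms(1) by (simp add: wf_query_def X_def)
  obtain l where l: "\<And>W. W \<subseteq> X \<Longrightarrow> 0 \<le> l W" "\<And>S. S \<subseteq> X \<Longrightarrow> g S = sum l (meeting X S)"
    using assms(2) by (auto simp: normal_def X_def)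
  \<comment> \<open>Rounding down preserves the statistics. As \<open>l W \<ge> 0\<close>, the floor
    is at least 1, so the power is below floor + 1 and hence at most twice the floor.\<close>
  define N where "N = (\<lambda>W. nat \<lfloor>2 powr l W\<rfloor>)"
  have l1: "1 \<le> 2 powr l W" if "W \<subseteq> X" for W using l(1)[OF that] by (simp add: ge_one_powr_ge_zero)
  have N: "1 \<le> N W" "real (N W) \<le> 2 powr l W" "2 powr l W / 2 \<le> real (N W)" if "W \<subseteq> X" for W
  proof -
    have "1 \<le> \<lfloor>2 powr l W\<rfloor>" using l1[OF that] by (simp add: le_floor_iff)
    moreover from this have "real (N W) = of_int \<lfloor>2 powr l W\<rfloor>" by (simp add: N_def)
    ultimately show "1 \<le> N W" "real (N W) \<le> 2 powr l W" "2 powr l W / 2 \<le> real (N W)"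
      using real_of_int_floor_add_one_gt[of "2 powr l W"] of_int_floor_le[of "2 powr l W"]
      by linarith+
  qed
  define Z where "Z = codes X N"
  have finZ: "finite Z" by (simp add: Z_def finite_codes finX)
  obtain tup :: "('v set \<Rightarrow> nat) \<Rightarrow> ('v \<rightharpoonup> nat)" where tup_dom: "\<forall>z. dom (tup z) = X"
    and tup_eq: "\<forall>S\<subseteq>X. \<forall>z\<in>Z. \<forall>z'\<in>Z.
      tup z |` S = tup z' |` S \<longleftrightarrow> (\<forall>W\<in>meeting X S. z W = z' W)"
    using exists_tuples[OF finX, of N] unfolding Z_def by blast
  have tup: "dom (tup z) = X" "S \<subseteq> X \<Longrightarrow> z \<in> Z \<Longrightarrow> z' \<in> Z \<Longrightarrow>
      tup z |` S = tup z' |` S \<longleftrightarrow> (\<forall>W\<in>meeting X S. z W = z' W)" for S z z'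
    using tup_dom tup_eq by blast+
  have restrict_eqD: "z W = z' W" if "restrict z M = restrict z' M" "W \<in> M" for z z' M and W :: "'v set"
    using that by (metis restrict_apply')
  \<comment> \<open>All relations are projections of one set of tuples, so these tuples lie in the
    natural join.\<close>
  define D where "D = (\<lambda>j. project (attrs Q j) (tup ` Z))"
  have project_D: "project U (D j) = (\<lambda>z. tup z |` U) ` Z" if "U \<subseteq> attrs Q j" for U j
    using that by (simp add: D_def project_def image_image Int_absorb1)
  have finD: "finite (D j)" for j by (simp add: D_def project_def finZ)
  have "database Q D"
    unfolding database_def
  proof (intro ballI conjI finD)
    fix j t assume "j \<in> {1..natoms Q}" "t \<in> D j"
    then obtain z where "t = tup z |` attrs Q j" by (auto simp: D_def project_def)
    then show "dom t = attrs Q j" using subA \<open>j \<in> {1..natoms Q}\<close> tup(1)[of z]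
      by (simp add: dom_restrict Int_absorb1)
  qed
  moreover have "satisfies D \<Sigma>"
    unfolding satisfies_def
  proof
    fix \<sigma> assume \<sigma>: "\<sigma> \<in> \<Sigma>"
    define j U V where "j = stat_rel \<sigma>" and "U = stat_U \<sigma>" and "V = stat_V \<sigma>"
    have j: "j \<in> {1..natoms Q}" and UV: "U \<subseteq> attrs Q j" "V \<subseteq> attrs Q j" and p: "0 < stat_p \<sigma>"
      and b: "1 \<le> stat_b \<sigma>"
      using assms(3)[OF \<sigma>] by (auto simp: simple_statistic_def j_def U_def V_def)
    have UVX: "U \<subseteq> X" "U \<union> V \<subseteq> X" using UV subA[OF j] by auto
    \<comment> \<open>The coordinates in \<open>A\<close> are those visible on \<open>U\<close>;
      once the value on \<open>U\<close> is fixed, they are fixed, and only the coordinates in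
      \<open>B\<close> can still vary on \<open>U \<union> V\<close>. So the products of
      \<open>N\<close> over \<open>A\<close> and \<open>B\<close> bound the number of values on
      \<open>U\<close> and the degrees.\<close>
    define A where "A = meeting X U"
    define B where "B = meeting X (U \<union> V) - meeting X U"
    have AB: "A \<subseteq> Pow X" "B \<subseteq> Pow X" "finite A" "finite B"
      by (auto simp: A_def B_def meeting_def finX)
    have N_AB: "1 \<le> N W" "real (N W) \<le> 2 powr l W" if "W \<in> A \<or> W \<in> B" for W
      using N[of W] AB that by auto
    have "card (project U (D j)) \<le> card ((\<lambda>z. restrict z A) ` Z)"
      unfolding project_D[OF UV(1)]
      by (rule card_image_le_if_factors[OF finZ]) (metis tup(2) UVX(1) A_def restrict_eqD)
    also have "\<dots> \<le> (\<Prod>W\<in>A. N W)" unfolding Z_def by (rule card_restrict_codes[OF finX AB(1) subset_refl])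
    finally have K: "card (project U (D j)) \<le> (\<Prod>W\<in>A. N W)" .
    have L: "tuple_degree (D j) V U u \<le> (\<Prod>W\<in>B. N W)" if u: "u \<in> project U (D j)" for u
    proof -
      obtain z0 where z0: "z0 \<in> Z" "u = tup z0 |` U" using u unfolding project_D[OF UV(1)] by blast
      define Z' where "Z' = {z\<in>Z. tup z |` U = u}"
      have Z': "z W = z0 W" if "z \<in> Z'" "W \<in> A" for z W
        using that z0 tup(2)[OF UVX(1), of z z0] by (auto simp: Z'_def A_def)
      have "{t \<in> project (U \<union> V) (D j). t |` U = u} = (\<lambda>z. tup z |` (U \<union> V)) ` Z'"
        using project_D[of "U \<union> V" j] UV by (auto simp: Z'_def Int_absorb1)
      then have "tuple_degree (D j) V U u = card ((\<lambda>z. tup z |` (U \<union> V)) ` Z')"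
        by (simp add: tuple_degree_def)
      also have "\<dots> \<le> card ((\<lambda>z. restrict z B) ` Z')"
      proof (rule card_image_le_if_factors)
        show "finite Z'" using finZ by (simp add: Z'_def)
        fix z z' assume z: "z \<in> Z'" "z' \<in> Z'" "restrict z B = restrict z' B"
        have "z W = z' W" if "W \<in> meeting X (U \<union> V)" for W
          using that Z'[OF z(1), of W] Z'[OF z(2), of W] restrict_eqD[OF z(3), of W]
          by (cases "W \<in> A") (auto simp: A_def B_def)
        then show "tup z |` (U \<union> V) = tup z' |` (U \<union> V)"
          using tup(2)[OF UVX(2)] z(1,2) by (auto simp: Z'_def)
      qed
      also have "\<dots> \<le> (\<Prod>W\<in>B. N W)"
        by (rule card_restrict_codes[OF finX AB(2)]) (auto simp: Z_def Z'_def)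
      finally show ?thesis .
    qed
    have prod1: "1 \<le> (\<Prod>W\<in>A. N W)" "1 \<le> (\<Prod>W\<in>B. N W)"
      by (rule prod_ge_1, use N_AB(1) in blast)+
    have "log 2 (real (\<Prod>W\<in>A. N W)) \<le> g U"
      using log_prod_le_sum[OF AB(3), of N l] N_AB l(2)[OF UVX(1)] by (simp add: A_def)
    then have "real_of_ereal (1 / stat_p \<sigma>) * log 2 (real (\<Prod>W\<in>A. N W)) \<le> real_of_ereal (1 / stat_p \<sigma>) * g U"
      using p by (intro mult_left_mono)
        (auto elim!: ereal_pos_cases simp: real_of_ereal_one_divide)
    moreover have "log 2 (real (\<Prod>W\<in>B. N W)) \<le> g (U \<union> V) - g U"
    proof -
      have "sum l B = sum l (meeting X (U \<union> V)) - sum l (meeting X U)"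
        unfolding B_def by (intro sum_diff finite_meeting finX meeting_mono) auto
      then show ?thesis using log_prod_le_sum[OF AB(4), of N l] N_AB l(2)[OF UVX(1)] l(2)[OF UVX(2)]
        by simp
    qed
    ultimately have "real_of_ereal (1 / stat_p \<sigma>) * log 2 (real (\<Prod>W\<in>A. N W))
        + log 2 (real (\<Prod>W\<in>B. N W)) \<le> stat_form \<sigma> g"
      by (simp add: stat_form_def cond_def U_def V_def)
    also have "\<dots> \<le> log 2 (stat_b \<sigma>)" by (rule assms(4)[OF \<sigma>])
    finally show "stat_norm D \<sigma> \<le> stat_b \<sigma>"
      unfolding stat_norm_def using b
      by (intro lp_norm_deg_seq_le[OF finD p K[unfolded j_def U_def] L[unfolded j_def U_def V_def] prod1])
        (auto simp: j_def U_def V_def)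
  qed
  moreover have "2 powr g (head Q) / 2 ^ 2 ^ card X \<le> real (card (query_result Q D))"
  proof -
    define M where "M = meeting X (head Q)"
    have M: "M \<subseteq> Pow X" "finite M" using finX by (auto simp: M_def meeting_def)
    have "card M \<le> card (Pow X)" using M finX by (intro card_mono) auto
    \<comment> \<open>At most \<open>2 ^ card X\<close> coordinates each lose a factor of at most 2,
      which is the origin of the constant.\<close>
    then have "(2::real) ^ card M \<le> 2 ^ 2 ^ card X" by (intro power_increasing) (auto simp: card_Pow finX)
    then have "2 powr g (head Q) / 2 ^ 2 ^ card X \<le> 2 powr sum l M / 2 ^ card M"
      using l(2)[OF headX] by (auto simp: M_def intro!: divide_left_mono)
    also have "\<dots> = (\<Prod>W\<in>M. 2 powr l W / 2)"
      using M(2) by (simp add: powr_sum prod_dividef)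
    also have "\<dots> \<le> (\<Prod>W\<in>M. real (N W))"
      using N(3) M(1) by (intro prod_mono) auto
    also have "\<dots> \<le> real (card ((\<lambda>z. restrict z M) ` Z))"
      unfolding Z_def of_nat_prod[symmetric]
      by (intro of_nat_mono card_restrict_all_codes finX M(1) N(1))
    \<comment> \<open>Here the tuple determines the code: its values on the head reveal all
      coordinates in \<open>M\<close>.\<close>
    also have "card ((\<lambda>z. restrict z M) ` Z) \<le> card ((\<lambda>z. tup z |` head Q) ` Z)"
      by (rule card_image_le_if_factors[OF finZ], rule restrict_ext) (use tup(2)[OF headX] in \<open>auto simp: M_def\<close>)
    also have "\<dots> \<le> card (query_result Q D)"
    proof (rule card_mono)
      show "finite (query_result Q D)"
        using finite_natural_join[OF _ \<open>database Q D\<close> finA] finX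
        by (simp add: query_result_def project_def X_def)
      have "tup ` Z \<subseteq> natural_join Q D"
        using tup_dom by (simp add: natural_join_def D_def project_def X_def image_subset_iff)
      then show "(\<lambda>z. tup z |` head Q) ` Z \<subseteq> query_result Q D"
        by (auto simp: query_result_def project_def)
    qed
    finally show ?thesis by simp
  qed
  ultimately show ?thesis unfolding X_def by blast
qed

text \<open>The constant is chosen before the statistics and both solutions, so it depends on
  \<open>Q\<close> only. The database for the lower bound takes values in \<open>nat\<close>, since
  the type \<open>'d\<close> of the upper bounds may have too few elements.\<close>

theorem theorem3p1:
  fixes Q :: "'v cquery"
  assumes "wf_query Q"
  shows "\<exists>c>0. \<forall>(\<Sigma> :: 'v statistic set) h w s y.
    finite \<Sigma> \<and> (\<forall>\<sigma>\<in>\<Sigma>. simple_statistic Q \<sigma>) \<and>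
    primal_optimal Q \<Sigma> h \<and> dual_optimal Q \<Sigma> w s y \<longrightarrow>
    (let B = 2 powr h (head Q) in
      ((\<forall>D :: nat \<Rightarrow> ('v, 'd) relation. database Q D \<and> satisfies D \<Sigma> \<longrightarrow>
          real (card (query_result Q D)) \<le> B) \<and>
       (\<exists>D :: nat \<Rightarrow> ('v, nat) relation. database Q D \<and> satisfies D \<Sigma> \<and>
          real (card (query_result Q D)) \<ge> c * B)) \<and>
      ((\<forall>D :: nat \<Rightarrow> ('v, 'd) relation. database Q D \<longrightarrow>
          real (card (query_result Q D)) \<le> norm_product \<Sigma> w D) \<and>
       (\<Prod>\<sigma>\<in>\<Sigma>. stat_b \<sigma> powr w \<sigma>) \<le> B \<and>
       (\<forall>D :: nat \<Rightarrow> ('v, 'd) relation. database Q D \<and> satisfies D \<Sigma> \<longrightarrow>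
          norm_product \<Sigma> w D \<le> B \<and> real (card (query_result Q D)) \<le> B)) \<and>
      ((\<forall>g. (\<forall>U\<subseteq>query_vars Q. 0 \<le> g U) \<and> g {} = 0 \<longrightarrow>
          (\<Sum>\<sigma>\<in>\<Sigma>. w \<sigma> * stat_form \<sigma> g) - g (head Q)
            \<ge> (\<Sum>\<tau>\<in>shannon_ineqs (query_vars Q). s \<tau> * shannon_form \<tau> g)) \<and>
       (\<forall>g. basic_shannon (query_vars Q) g \<longrightarrow>
          g (head Q) \<le> (\<Sum>\<sigma>\<in>\<Sigma>. w \<sigma> * stat_form \<sigma> g))))"
proof (intro exI[of _ "1 / 2 ^ 2 ^ card (query_vars Q)"] conjI allI impI)
  show "(0 :: real) < 1 / 2 ^ 2 ^ card (query_vars Q)" by simp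
  fix \<Sigma> :: "'v statistic set" and h w s y
  assume "finite \<Sigma> \<and> (\<forall>\<sigma>\<in>\<Sigma>. simple_statistic Q \<sigma>) \<and>
    primal_optimal Q \<Sigma> h \<and> dual_optimal Q \<Sigma> w s y"
  then have fin: "finite \<Sigma>" and stats: "\<And>\<sigma>. \<sigma> \<in> \<Sigma> \<Longrightarrow> simple_statistic Q \<sigma>"
    and primal: "primal_optimal Q \<Sigma> h" and dual: "dual_optimal Q \<Sigma> w s y"
    by auto
  let ?X = "query_vars Q"
  define B where "B = 2 powr h (head Q)"
  have finA: "finite (attrs Q j)" and subA: "attrs Q j \<subseteq> ?X" if "j \<in> {1..natoms Q}" for j
    using assms that by (auto simp: wf_query_def query_vars_def)
  have finX: "finite ?X" and headX: "head Q \<subseteq> ?X"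
    using assms by (auto simp: wf_query_def query_vars_def)
  have feas: "dual_feasible Q \<Sigma> w s y"
    and opt: "\<And>w' s' y'. dual_feasible Q \<Sigma> w' s' y' \<Longrightarrow> dual_value \<Sigma> w \<le> dual_value \<Sigma> w'"
    using dual by (auto simp: dual_optimal_def)
  have w: "0 \<le> w \<sigma>" if "\<sigma> \<in> \<Sigma>" for \<sigma> using feas that by (simp add: dual_feasible_def)
  have rel: "stat_rel \<sigma> \<in> {1..natoms Q}" and b: "1 \<le> stat_b \<sigma>"
    and UV: "stat_U \<sigma> \<union> stat_V \<sigma> \<subseteq> ?X" if "\<sigma> \<in> \<Sigma>" for \<sigma>
    using stats[OF that] subA[of "stat_rel \<sigma>"] by (auto simp: simple_statistic_def)
  \<comment> \<open>Strong duality yields some dual solution of value at most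
    \<open>h (head Q)\<close>, and the given optimal one is no worse.\<close>
  have "dual_value \<Sigma> w \<le> h (head Q)"
    using strong_duality[OF finX fin primal] opt by (blast intro: order_trans)
  then have prod_b: "(\<Prod>\<sigma>\<in>\<Sigma>. stat_b \<sigma> powr w \<sigma>) \<le> B"
    using prod_powr_eq_powr_sum[OF fin, of stat_b w] b
    by (force simp: dual_value_def B_def)
  have bound: "real (card (query_result Q D)) \<le> norm_product \<Sigma> w D"
    if "database Q D" for D :: "nat \<Rightarrow> ('v, 'd) relation"
    by (rule query_result_le_norm_product[OF finX headX fin stats feas that])
  have norm_le: "norm_product \<Sigma> w D \<le> B" if "satisfies D \<Sigma>" for D :: "nat \<Rightarrow> ('v, 'd) relation"
  proof -
    have "norm_product \<Sigma> w D \<le> (\<Prod>\<sigma>\<in>\<Sigma>. stat_b \<sigma> powr w \<sigma>)"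
      unfolding norm_product_def
    proof (intro prod_mono conjI powr_mono2)
      show "0 \<le> stat_norm D \<sigma>" for \<sigma> by (simp add: stat_norm_def lp_norm_def)
      show "stat_norm D \<sigma> \<le> stat_b \<sigma>" if "\<sigma> \<in> \<Sigma>" for \<sigma>
        using \<open>satisfies D \<Sigma>\<close> that by (simp add: satisfies_def)
    qed (simp_all add: w)
    then show ?thesis using prod_b by simp
  qed
  have tight: "\<exists>D :: nat \<Rightarrow> ('v, nat) relation. database Q D \<and> satisfies D \<Sigma> \<and>
      1 / 2 ^ 2 ^ card ?X * B \<le> real (card (query_result Q D))"
  proof -
    have h: "basic_shannon ?X h" "\<And>\<sigma>. \<sigma> \<in> \<Sigma> \<Longrightarrow> stat_form \<sigma> h \<le> log 2 (stat_b \<sigma>)"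
      using primal by (auto simp: primal_optimal_def primal_feasible_def)
    obtain g where g: "normal ?X g" "\<And>S. S \<subseteq> ?X \<Longrightarrow> g S \<le> h S"
      "\<And>x. x \<in> ?X \<Longrightarrow> g {x} = h {x}" "h (head Q) \<le> g (head Q)"
      using exists_normal_below[OF finX h(1) headX] by blast
    have "g {} = h {}" using normal_empty[OF g(1)] h(1) by (simp add: basic_shannon_def)
    then have "stat_form \<sigma> g \<le> stat_form \<sigma> h" if "\<sigma> \<in> \<Sigma>" for \<sigma>
      using stats[OF that] finA[OF rel[OF that]] subA[OF rel[OF that]] g(2,3)
      by (intro stat_form_mono_simple[where X = ?X]) auto
    then have le: "stat_form \<sigma> g \<le> log 2 (stat_b \<sigma>)" if "\<sigma> \<in> \<Sigma>" for \<sigma>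
      using h(2)[OF that] that by fastforce
    from exists_database_of_normal[OF assms g(1) stats le]
    obtain D :: "nat \<Rightarrow> ('v, nat) relation" where D: "database Q D" "satisfies D \<Sigma>"
      "2 powr g (head Q) / 2 ^ 2 ^ card ?X \<le> real (card (query_result Q D))" by blast
    have "B \<le> 2 powr g (head Q)" using g(4) by (simp add: B_def)
    then have "1 / 2 ^ 2 ^ card ?X * B \<le> 2 powr g (head Q) / 2 ^ 2 ^ card ?X"
      by (simp add: divide_right_mono)
    then show ?thesis using D by (intro exI[of _ D]) simp
  qed
  have cert: "(\<Sum>\<tau>\<in>shannon_ineqs ?X. s \<tau> * shannon_form \<tau> g)
      \<le> (\<Sum>\<sigma>\<in>\<Sigma>. w \<sigma> * stat_form \<sigma> g) - g (head Q)"
    if "\<forall>U\<subseteq>?X. 0 \<le> g U" "g {} = 0" for g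
    using that by (intro dual_feasible_certificate[OF finX UV headX feas]) auto
  have shannon: "g (head Q) \<le> (\<Sum>\<sigma>\<in>\<Sigma>. w \<sigma> * stat_form \<sigma> g)" if "basic_shannon ?X g" for g
    by (rule dual_feasible_bound[OF finX UV headX feas that])
  show "let B = 2 powr h (head Q) in
      ((\<forall>D :: nat \<Rightarrow> ('v, 'd) relation. database Q D \<and> satisfies D \<Sigma> \<longrightarrow>
          real (card (query_result Q D)) \<le> B) \<and>
       (\<exists>D :: nat \<Rightarrow> ('v, nat) relation. database Q D \<and> satisfies D \<Sigma> \<and>
          real (card (query_result Q D)) \<ge> 1 / 2 ^ 2 ^ card ?X * B)) \<and>
      ((\<forall>D :: nat \<Rightarrow> ('v, 'd) relation. database Q D \<longrightarrow>
          real (card (query_result Q D)) \<le> norm_product \<Sigma> w D) \<and>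
       (\<Prod>\<sigma>\<in>\<Sigma>. stat_b \<sigma> powr w \<sigma>) \<le> B \<and>
       (\<forall>D :: nat \<Rightarrow> ('v, 'd) relation. database Q D \<and> satisfies D \<Sigma> \<longrightarrow>
          norm_product \<Sigma> w D \<le> B \<and> real (card (query_result Q D)) \<le> B)) \<and>
      ((\<forall>g. (\<forall>U\<subseteq>?X. 0 \<le> g U) \<and> g {} = 0 \<longrightarrow>
          (\<Sum>\<sigma>\<in>\<Sigma>. w \<sigma> * stat_form \<sigma> g) - g (head Q)
            \<ge> (\<Sum>\<tau>\<in>shannon_ineqs ?X. s \<tau> * shannon_form \<tau> g)) \<and>
       (\<forall>g. basic_shannon ?X g \<longrightarrow>
          g (head Q) \<le> (\<Sum>\<sigma>\<in>\<Sigma>. w \<sigma> * stat_form \<sigma> g)))"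
    unfolding Let_def B_def[symmetric]
    using bound norm_le tight prod_b cert shannon order_trans by blast
qed

end
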